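(* Let $\kappa=(\kappa_1,\ldots,\kappa_n)\in\mathbb{N}^n$, let each $C_i\subset\mathbb{C}$, $i\in\{1,\ldots,n\}$, be an open disk or the open exterior of a disk, and let $f,g\in\mathbb{C}_\kappa[z_1,\ldots,z_n]$. Suppose that (i) $f$ is $C_1\times\cdots\times C_n$-stable and $\deg_{z_j}(f)=\kappa_j$ whenever $C_j$ is the exterior of a disk, and (ii) $g$ is $(\mathbb{C}\setminus C_1)\times\cdots\times(\mathbb{C}\setminus C_n)$-stable and $\deg_{z_j}(g)=\kappa_j$ whenever $C_j$ is a disk. Then $\{f,g\}_\kappa\neq 0$.
   Context: $\mathbb{N}$ contains $0$. $\mathbb{C}_\kappa[z_1,\ldots,z_n]$ is the space of complex polynomials $f$ with $\deg_{z_i}(f)\le\kappa_i$ for all $i$. For $\Omega\subset\mathbb{C}^n$, $f$ is $\Omega$-stable if $f(z)\neq 0$ for all $z\in\Omega$. For polynomials $f,g$ in $n$ variables, $$\{f,g\}_\kappa=\sum_{\alpha\le\kappa}(-1)^{\alpha}f^{(\alpha)}(0)\,g^{(\kappa-\alpha)}(0),$$ where the sum is over $\alpha\in\mathbb{N}^n$ with $\alpha_i\le\kappa_i$ for all $i$, $(-1)^\alpha=(-1)^{\alpha_1+\cdots+\alpha_n}$, and $f^{(\alpha)}=\partial^{\alpha_1+\cdots+\alpha_n}f/\partial z_1^{\alpha_1}\cdots\partial z_n^{\alpha_n}$. *)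

theory Defs
  imports Complex_Main "HOL-Library.Poly_Mapping" "HOL-Library.FuncSet"
begin

text \<open>
  A complex polynomial is a finitely supported map from monomials to coefficients; a monomial is
  a finitely supported map from variable indices to exponents. A polynomial in \<open>n\<close> variables uses
  only the indices \<open>{1..n}\<close>, and points of complex \<open>n\<close>-space are the extensional functions
  \<open>{1..n} \<rightarrow>\<^sub>E UNIV\<close>.
\<close>

type_synonym cpoly = "(nat \<Rightarrow>\<^sub>0 nat) \<Rightarrow>\<^sub>0 complex"

definition peval :: "cpoly \<Rightarrow> (nat \<Rightarrow> complex) \<Rightarrow> complex" where
  "peval f z = (\<Sum>m\<in>Poly_Mapping.keys f.
     Poly_Mapping.lookup f m * (\<Prod>i\<in>Poly_Mapping.keys m. z i ^ Poly_Mapping.lookup m i))"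

text \<open>By convention the zero polynomial has degree \<open>0\<close> in each variable.\<close>

definition deg_in :: "nat \<Rightarrow> cpoly \<Rightarrow> nat" where
  "deg_in i f = Max (insert 0 ((\<lambda>m. Poly_Mapping.lookup m i) ` Poly_Mapping.keys f))"

definition polys :: "nat \<Rightarrow> (nat \<Rightarrow> nat) \<Rightarrow> cpoly set" where
  "polys n \<kappa> = {f. (\<forall>m\<in>Poly_Mapping.keys f. Poly_Mapping.keys m \<subseteq> {1..n}) \<and>
                   (\<forall>i\<in>{1..n}. deg_in i f \<le> \<kappa> i)}"

definition stable :: "(nat \<Rightarrow> complex) set \<Rightarrow> cpoly \<Rightarrow> bool" where
  "stable \<Omega> f \<longleftrightarrow> (\<forall>z\<in>\<Omega>. peval f z \<noteq> 0)"

text \<open>If \<open>z\<^sub>i\<close> does not occur in \<open>m\<close>, the truncated subtraction below is harmless, since the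
  coefficient is then \<open>0\<close>. The lemma \<open>has_field_derivative_partial\<close> confirms that this is the
  analytic partial derivative.\<close>

definition partial :: "nat \<Rightarrow> cpoly \<Rightarrow> cpoly" where
  "partial i f = (\<Sum>m\<in>Poly_Mapping.keys f.
     Poly_Mapping.single (m - Poly_Mapping.single i 1)
       (of_nat (Poly_Mapping.lookup m i) * Poly_Mapping.lookup f m))"

definition partials :: "nat \<Rightarrow> (nat \<Rightarrow> nat) \<Rightarrow> cpoly \<Rightarrow> cpoly" where
  "partials n \<alpha> f = fold (\<lambda>i. partial i ^^ \<alpha> i) [1..<Suc n] f"

definition bracket :: "nat \<Rightarrow> (nat \<Rightarrow> nat) \<Rightarrow> cpoly \<Rightarrow> cpoly \<Rightarrow> complex" where
  "bracket n \<kappa> f g = (\<Sum>\<alpha> \<in> (\<Pi>\<^sub>E i\<in>{1..n}. {..\<kappa> i}).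
     (- 1) ^ (\<Sum>i\<in>{1..n}. \<alpha> i) *
     peval (partials n \<alpha> f) (\<lambda>_. 0) * peval (partials n (\<lambda>i. \<kappa> i - \<alpha> i) g) (\<lambda>_. 0))"

definition open_disk :: "complex set \<Rightarrow> bool" where
  "open_disk S \<longleftrightarrow> (\<exists>c r. r > 0 \<and> S = {z. cmod (z - c) < r})"

definition open_disk_exterior :: "complex set \<Rightarrow> bool" where
  "open_disk_exterior S \<longleftrightarrow> (\<exists>c r. r > 0 \<and> S = {z. cmod (z - c) > r})"

lemma peval_superset:
  assumes "finite A" "Poly_Mapping.keys f \<subseteq> A"
  shows "peval f z = (\<Sum>m\<in>A.
     Poly_Mapping.lookup f m * (\<Prod>i\<in>Poly_Mapping.keys m. z i ^ Poly_Mapping.lookup m i))"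
  unfolding peval_def using assms
  by (intro sum.mono_neutral_left) (auto simp: in_keys_iff)

lemma peval_zero [simp]: "peval 0 z = 0"
  by (simp add: peval_def)

lemma peval_add: "peval (f + g) z = peval f z + peval g z"
proof -
  let ?A = "Poly_Mapping.keys f \<union> Poly_Mapping.keys g"
  have "Poly_Mapping.keys (f + g) \<subseteq> ?A" by (rule Poly_Mapping.keys_add)
  then show ?thesis
    by (simp add: peval_superset[of ?A] lookup_add ring_distribs sum.distrib)
qed

lemma peval_sum: "peval (\<Sum>x\<in>A. h x) z = (\<Sum>x\<in>A. peval (h x) z)"
  by (induction A rule: infinite_finite_induct) (auto simp: peval_add)

lemma peval_single:
  "peval (Poly_Mapping.single m c) z =
     c * (\<Prod>i\<in>Poly_Mapping.keys m. z i ^ Poly_Mapping.lookup m i)"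
  by (simp add: peval_superset[of "{m}"])

lemma monomial_superset:
  fixes z :: "nat \<Rightarrow> complex"
  assumes "finite A" "Poly_Mapping.keys m \<subseteq> A"
  shows "(\<Prod>i\<in>Poly_Mapping.keys m. z i ^ Poly_Mapping.lookup m i) =
         (\<Prod>i\<in>A. z i ^ Poly_Mapping.lookup m i)"
  using assms by (intro prod.mono_neutral_left) (auto simp: in_keys_iff)

lemma has_field_derivative_partial:
  "((\<lambda>t. peval f (z(i := t))) has_field_derivative peval (partial i f) z) (at (z i))"
proof -
  have *: "((\<lambda>t. Poly_Mapping.lookup f m *
              (\<Prod>j\<in>Poly_Mapping.keys m. (z(i := t)) j ^ Poly_Mapping.lookup m j))
         has_field_derivative
           peval (Poly_Mapping.single (m - Poly_Mapping.single i 1)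
             (of_nat (Poly_Mapping.lookup m i) * Poly_Mapping.lookup f m)) z) (at (z i))" for m
  proof -
    define A where "A = Poly_Mapping.keys m - {i}"
    have A: "finite A" "i \<notin> A" by (auto simp: A_def)
    let ?P = "\<Prod>j\<in>A. z j ^ Poly_Mapping.lookup m j"
    have k1: "Poly_Mapping.keys m \<subseteq> insert i A" by (auto simp: A_def)
    have k2: "Poly_Mapping.keys (m - Poly_Mapping.single i 1) \<subseteq> insert i A"
      by (auto simp: A_def in_keys_iff lookup_minus)
    have e1: "(\<Prod>j\<in>Poly_Mapping.keys m. (z(i := t)) j ^ Poly_Mapping.lookup m j)
        = t ^ Poly_Mapping.lookup m i * ?P" for t
    proof -
      have "(\<Prod>j\<in>A. (z(i := t)) j ^ Poly_Mapping.lookup m j) = ?P"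
        using A by (intro prod.cong) auto
      then show ?thesis
        using A by (subst monomial_superset[OF _ k1]) auto
    qed
    have "(\<Prod>j\<in>A. z j ^ Poly_Mapping.lookup (m - Poly_Mapping.single i 1) j) = ?P"
      using A by (intro prod.cong) (auto simp: lookup_minus lookup_single when_def)
    then have e2: "peval (Poly_Mapping.single (m - Poly_Mapping.single i 1)
             (of_nat (Poly_Mapping.lookup m i) * Poly_Mapping.lookup f m)) z
        = of_nat (Poly_Mapping.lookup m i) * Poly_Mapping.lookup f m *
            (z i ^ (Poly_Mapping.lookup m i - 1) * ?P)"
      unfolding peval_single using A
      by (subst monomial_superset[OF _ k2]) (auto simp: lookup_minus)
    show ?thesis
      unfolding e1 e2 by (auto intro!: derivative_eq_intros)
  qed
  show ?thesis
    unfolding partial_def peval_sum by (subst peval_def) (intro DERIV_sum *)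
qed

end

theory Submission
  imports Defs "HOL-Analysis.Analysis" "HOL-Computational_Algebra.Fundamental_Theorem_Algebra"
begin

text \<open>
  For one variable the assertion is Grace's theorem on apolar polynomials. Several variables can be
  handled one at a time, but pairing off one variable of \<open>f(z) g(w)\<close> produces a polynomial that is
  no longer a product, so a version of Grace's theorem is needed for bivariate polynomials
  \<open>H(z, w)\<close> that have no zeros with \<open>z \<in> C\<close> and \<open>w \<notin> C\<close>.

  That version fails for an open disc and its exact complement: for \<open>H(z, w) = z + w\<close>,
  \<open>\<kappa> = 1\<close> and the unit disc the bracket is \<open>0\<close>. It becomes true as soon as there is some room
  between the two regions. The room comes from compactness: \<open>g\<close> has no zeros on a product of closed
  discs of the Riemann sphere, hence none on slightly larger discs
  (\<open>nonvanishing_polydisc_fatten\<close>). This requires that \<open>g\<close> does not vanish at infinity either,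
  and likewise for \<open>f\<close>. The degree conditions ensure that (\<open>chart_nonvanishing\<close>): full degree
  in \<open>z\<^sub>j\<close> says that the leading coefficient in \<open>z\<^sub>j\<close> is not identically zero, and then it has no
  zeros at all, since a zero would send a root of a nearby slice to infinity.

  Moebius coordinates turn each region into the unit disc. The bracket then becomes
  \<open>\<Sum>\<^sub>b (-1)\<^sup>b p\<^sub>b q\<^sub>b / (k choose b)\<close> in each variable (\<open>pairing_charts\<close>). In this form the bivariate
  theorem (\<open>bivariate_pairing_nonzero\<close>) has a short inductive proof. One step of polarisation,
  which does not create zeros by Laguerre's theorem on polar derivatives
  (\<open>laguerre_polar_derivative\<close>), makes \<open>H\<close> affine in one new variable on each side, and
  Asano's contraction of this affine pair (\<open>asano_contraction\<close>) lowers the degree bound by one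
  while preserving the pairing. Induction on the number of variables
  (\<open>multivariate_pairing_nonzero\<close>) completes the argument.
\<close>

section \<open>Zero-free polynomials on a disc\<close>

lemma poly_nonvanishing_factor:
  fixes p :: "complex poly"
  assumes nz: "\<And>x. norm x < R \<Longrightarrow> poly p x \<noteq> 0" and "degree p \<noteq> 0"
  obtains \<zeta> q where "p = [:- \<zeta>, 1:] * q" "R \<le> norm \<zeta>" "degree p = Suc (degree q)"
    "\<And>x. norm x < R \<Longrightarrow> poly q x \<noteq> 0"
proof -
  have "\<not> constant (poly p)"
    using assms(2) by (simp add: constant_degree)
  then obtain \<zeta> where \<zeta>: "poly p \<zeta> = 0"
    using Fundamental_Theorem_Algebra.fundamental_theorem_of_algebra by blast
  then obtain q where q: "p = [:- \<zeta>, 1:] * q"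
    by (auto simp: poly_eq_0_iff_dvd elim: dvdE)
  have "q \<noteq> 0"
    using assms(2) q by auto
  then have "degree p = Suc (degree q)"
    unfolding q by (subst degree_mult_eq) auto
  moreover have "R \<le> norm \<zeta>"
    using nz[of \<zeta>] \<zeta> by force
  moreover have "poly q x \<noteq> 0" if "norm x < R" for x
    using nz[OF that] q by auto
  ultimately show ?thesis
    using q that by blast
qed

text \<open>
  Each factor grows by at most \<open>\<bar>x - \<zeta>\<bar> \<le> 2 \<bar>\<zeta>\<bar>\<close>, because the roots \<open>\<zeta>\<close> lie outside the open unit
  disc. The bound depends only on \<open>k\<close>, so it survives passage to a limit of polynomials; it
  plays the role of Hurwitz's theorem below.
\<close>

lemma norm_poly_le_at_0:
  fixes p :: "complex poly"
  assumes "degree p \<le> k" and "\<And>x. norm x < 1 \<Longrightarrow> poly p x \<noteq> 0" and x: "norm x < 1"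
  shows "norm (poly p x) \<le> 2 ^ k * norm (poly p 0)"
  using assms(1,2)
proof (induction k arbitrary: p)
  case 0
  then obtain c where "p = [:c:]" by (metis degree_eq_zeroE le_0_eq)
  then show ?case by simp
next
  case (Suc k)
  show ?case
  proof (cases "degree p = 0")
    case True
    then obtain c where "p = [:c:]" by (metis degree_eq_zeroE)
    moreover have "1 * norm c \<le> 2 ^ Suc k * norm c"
      by (intro mult_right_mono) (auto simp: one_le_power simp del: power_Suc)
    ultimately show ?thesis by simp
  next
    case False
    obtain \<zeta> q where q: "p = [:- \<zeta>, 1:] * q" "1 \<le> norm \<zeta>" "degree p = Suc (degree q)"
      "\<And>x. norm x < 1 \<Longrightarrow> poly q x \<noteq> 0"
      using poly_nonvanishing_factor[of 1 p] Suc.prems False by blast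
    have "norm (x - \<zeta>) \<le> norm x + norm \<zeta>"
      by (rule norm_triangle_ineq4)
    then have "norm (x - \<zeta>) \<le> 2 * norm \<zeta>"
      using q(2) x by linarith
    moreover have "norm (poly q x) \<le> 2 ^ k * norm (poly q 0)"
      using Suc q by auto
    ultimately have "norm (x - \<zeta>) * norm (poly q x) \<le> (2 * norm \<zeta>) * (2 ^ k * norm (poly q 0))"
      by (intro mult_mono) auto
    moreover have "poly p y = (y - \<zeta>) * poly q y" for y
      unfolding q(1) by (simp add: algebra_simps)
    ultimately show ?thesis
      by (simp add: norm_mult mult_ac)
  qed
qed

text \<open>
  The quotient \<open>- p'(z) / (k p(z))\<close> is the average of the points \<open>1 / (\<zeta> - z)\<close> over the roots
  \<open>\<zeta>\<close>, padded with zeros, which stand for roots at infinity, up to \<open>k\<close> terms. Hence it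
  stays in every convex set that contains \<open>0\<close> and all these points.
\<close>

lemma log_derivative_in_convex:
  fixes p :: "complex poly"
  assumes "degree p \<le> k" and "\<And>x. norm x < R \<Longrightarrow> poly p x \<noteq> 0" and z: "norm z < R"
    and K: "convex K" "0 \<in> K" "\<And>\<zeta>. R \<le> norm \<zeta> \<Longrightarrow> inverse (\<zeta> - z) \<in> K"
  shows "\<exists>w\<in>K. poly (pderiv p) z = - of_nat k * w * poly p z"
  using assms(1,2)
proof (induction k arbitrary: p)
  case 0
  then obtain c where "p = [:c:]" by (metis degree_eq_zeroE le_0_eq)
  then show ?case using K(2) by (auto simp: pderiv_pCons)
next
  case (Suc k)
  show ?case
  proof (cases "degree p = 0")
    case True
    then obtain c where "p = [:c:]" by (metis degree_eq_zeroE)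
    then show ?thesis using K(2) by (auto simp: pderiv_pCons intro!: bexI[of _ 0])
  next
    case False
    obtain \<zeta> q where q: "p = [:- \<zeta>, 1:] * q" "R \<le> norm \<zeta>" "degree p = Suc (degree q)"
      "\<And>x. norm x < R \<Longrightarrow> poly q x \<noteq> 0"
      using poly_nonvanishing_factor[of R p] Suc.prems False by blast
    obtain w where w: "w \<in> K" "poly (pderiv q) z = - of_nat k * w * poly q z"
      using Suc.IH[of q] Suc.prems(1) q(3,4) by auto
    let ?v = "inverse (\<zeta> - z)" and ?n = "real (Suc k)"
    have ne: "\<zeta> - z \<noteq> 0"
      using z q(2) by auto
    have "(1 / ?n) *\<^sub>R ?v + (real k / ?n) *\<^sub>R w \<in> K"
      using K(1) K(3)[OF q(2)] w(1) by (rule convexD) (auto simp: field_simps)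
    moreover have "poly (pderiv p) z
        = - of_nat (Suc k) * ((1 / ?n) *\<^sub>R ?v + (real k / ?n) *\<^sub>R w) * poly p z"
    proof -
      have e: "of_nat (Suc k) * ((1 / ?n) *\<^sub>R ?v + (real k / ?n) *\<^sub>R w) = ?v + of_nat k * w"
        using of_nat_neq_0[of k, where ?'a = complex]
        by (simp add: scaleR_conv_of_real distrib_left del: of_nat_Suc)
      have "poly (pderiv p) z = (z - \<zeta>) * (- of_nat k * w * poly q z) + poly q z"
        unfolding q(1) pderiv_mult by (simp add: w(2) pderiv_pCons algebra_simps)
      also have "\<dots> = - (?v + of_nat k * w) * ((z - \<zeta>) * poly q z)"
        using ne by (simp add: field_simps)
      finally show ?thesis
        unfolding mult_minus_left e by (simp add: q(1) left_diff_distrib)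
    qed
    ultimately show ?thesis by blast
  qed
qed

text \<open>
  The inversion \<open>\<zeta> \<mapsto> 1 / (\<zeta> - z)\<close> maps the complement of the disc, with infinity, onto a
  closed disc \<open>K\<close>, which is convex. If the polar derivative vanished, the averaged point
  of \<open>K\<close> would be \<open>1 / (s - z)\<close>, which is the image of the point \<open>s\<close> inside the disc.
\<close>

theorem laguerre_polar_derivative:
  fixes p :: "complex poly"
  assumes k: "k > 0" and deg: "degree p \<le> k" and nz: "\<And>x. norm x < R \<Longrightarrow> poly p x \<noteq> 0"
    and z: "norm z < R" and s: "norm s < R"
  shows "of_nat k * poly p z + (s - z) * poly (pderiv p) z \<noteq> 0"
proof
  assume *: "of_nat k * poly p z + (s - z) * poly (pderiv p) z = 0"
  define D where "D = R\<^sup>2 - (norm z)\<^sup>2"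
  have D: "D > 0"
    using z by (simp add: D_def power_strict_mono)
  have R: "R > 0"
    using z norm_ge_zero[of z] by linarith
  \<comment> \<open>Centre and radius of the image circle, found by completing the square in
    \<open>R\<^sup>2 \<bar>w\<bar>\<^sup>2 \<le> \<bar>1 + z w\<bar>\<^sup>2\<close>, which is \<open>R \<le> \<bar>\<zeta>\<bar>\<close> written in \<open>w = 1 / (\<zeta> - z)\<close>.\<close>
  define K where "K = cball (cnj z / of_real D) (R / D)"
  have K_iff: "w \<in> K \<longleftrightarrow> R * norm w \<le> norm (1 + z * w)" for w
  proof -
    have "w \<in> K \<longleftrightarrow> (norm (of_real D * w - cnj z))\<^sup>2 \<le> R\<^sup>2"
    proof -
      have "norm (cnj z / of_real D - w) = norm (of_real D * w - cnj z) / D"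
      proof -
        have "cnj z / of_real D - w = - (of_real D * w - cnj z) / of_real D"
          using D by (simp add: field_simps)
        then show ?thesis
          using D by (simp add: norm_divide del: minus_diff_eq)
      qed
      then show ?thesis
        using D R by (simp add: K_def dist_norm field_simps flip: abs_le_square_iff)
    qed
    also have "\<dots> \<longleftrightarrow> D * (R * norm w)\<^sup>2 \<le> D * (norm (1 + z * w))\<^sup>2"
    proof -
      have "(norm (of_real D * w - cnj z))\<^sup>2 - R\<^sup>2 = D * (R * norm w)\<^sup>2 - D * (norm (1 + z * w))\<^sup>2"
        unfolding power_mult_distrib cmod_power2 D_def
        by (simp add: power2_eq_square algebra_simps)
      then show ?thesis by linarith
    qed
    also have "\<dots> \<longleftrightarrow> R * norm w \<le> norm (1 + z * w)"
      using D R by (simp flip: abs_le_square_iff)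
    finally show ?thesis .
  qed
  have "\<exists>w\<in>K. poly (pderiv p) z = - of_nat k * w * poly p z"
  proof (rule log_derivative_in_convex[OF deg nz z])
    show "convex K" "0 \<in> K"
      by (simp_all add: K_iff) (simp add: K_def)
    show "inverse (\<zeta> - z) \<in> K" if "R \<le> norm \<zeta>" for \<zeta>
    proof -
      have ne: "\<zeta> - z \<noteq> 0"
        using z that by auto
      then have "1 + z * inverse (\<zeta> - z) = \<zeta> * inverse (\<zeta> - z)"
        by (simp add: field_simps)
      then show ?thesis
        unfolding K_iff using that by (simp add: norm_mult mult_right_mono)
    qed
  qed
  then obtain w where w: "w \<in> K" "poly (pderiv p) z = - of_nat k * w * poly p z"
    by blast
  have "of_nat k * poly p z * (1 - (s - z) * w) = 0"
    using * w(2) by (simp add: algebra_simps)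
  then have "1 - (s - z) * w = 0"
    using k nz[OF z] by auto
  then have e: "1 + z * w = s * w"
    by (simp add: algebra_simps)
  then have "w \<noteq> 0"
    by auto
  moreover have "R * norm w \<le> norm s * norm w"
    using w(1) unfolding K_iff e norm_mult .
  ultimately show False
    using s by simp
qed

section \<open>Asano contraction and the bivariate pairing\<close>

text \<open>
  Asano's contraction. Substituting \<open>t = \<rho> s\<close> gives a quadratic in \<open>s\<close> without roots in the
  unit disc, so the product \<open>a / (\<rho> d)\<close> of its roots has modulus at least \<open>1\<close>. The strict
  inequality \<open>\<rho> > 1\<close> is essential: \<open>1 + s t\<close> has no zero with \<open>\<bar>s\<bar> < 1\<close>, \<open>\<bar>t\<bar> \<le> 1\<close>,
  although \<open>a = d\<close>.
\<close>

lemma asano_contraction: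
  fixes a b c d :: complex
  assumes \<rho>: "\<rho> > 1"
    and nz: "\<And>s t. norm s < 1 \<Longrightarrow> norm t < \<rho> \<Longrightarrow> a + b * s + c * t + d * s * t \<noteq> 0"
  shows "a \<noteq> d"
proof
  assume "a = d"
  have "a \<noteq> 0"
    using nz[of 0 0] \<rho> by simp
  define r where "r = complex_of_real \<rho>"
  define p where "p = [:a, b + c * r, d * r:]"
  have p: "poly p s = a + b * s + c * (r * s) + d * s * (r * s)" for s
    by (simp add: p_def algebra_simps)
  have d2: "degree p = 2"
    using \<rho> \<open>a \<noteq> 0\<close> \<open>a = d\<close> by (auto simp: p_def r_def)
  have nzp: "poly p s \<noteq> 0" if "norm s < 1" for s
    using nz[of s "r * s"] that \<rho> unfolding p by (simp add: r_def norm_mult)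
  obtain x q where q: "p = [:- x, 1:] * q" "1 \<le> norm x" "degree p = Suc (degree q)"
      "\<And>s. norm s < 1 \<Longrightarrow> poly q s \<noteq> 0"
    using poly_nonvanishing_factor[of 1 p] nzp d2 by auto
  then obtain y q' where q': "q = [:- y, 1:] * q'" "1 \<le> norm y" "degree q = Suc (degree q')"
    using poly_nonvanishing_factor[of 1 q] d2 by (metis One_nat_def Suc_1 nat.inject nat.simps(3))
  have "degree q' = 0"
    using q(3) q'(3) d2 by simp
  then obtain k where k: "q' = [:k:]"
    by (metis degree_eq_zeroE)
  have pe: "p = [:x * y * k, - (x + y) * k, k:]"
    unfolding q(1) q'(1) k by (simp add: algebra_simps)
  then have "a = x * y * k" "d * r = k"
    by (auto simp: p_def)
  then have "x * y * r = 1"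
    using \<open>a = d\<close> \<open>a \<noteq> 0\<close> by (auto simp: mult.assoc)
  then have "norm x * norm y * \<rho> = 1"
    using \<rho> by (metis norm_mult norm_of_real norm_one r_def abs_of_pos less_trans zero_less_one)
  moreover have "1 * 1 \<le> norm x * norm y"
    using q(2) q'(2) by (intro mult_mono) auto
  then have "1 * \<rho> \<le> norm x * norm y * \<rho>"
    using \<rho> by (intro mult_right_mono) auto
  ultimately show False
    using \<rho> by simp
qed

text \<open>
  The one-variable bracket \<open>{p, q}\<^sub>k\<close> up to the factor \<open>k!\<close>, after the second argument has been
  reversed by \<open>q(x) \<mapsto> x\<^sup>k q(1/x)\<close>. In this form both arguments live on a disc around the
  origin.
\<close>

definition pairing :: "nat \<Rightarrow> complex poly \<Rightarrow> complex poly \<Rightarrow> complex" where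
  "pairing k p q = (\<Sum>b\<le>k. (- 1) ^ b * coeff p b * coeff q b / of_nat (k choose b))"

text \<open>
  The polar derivative of \<open>p\<close>, divided by \<open>k\<close>, is affine in the pole \<open>s\<close>; it equals
  \<open>polar0 k p + s \<cdot> polar1 k p\<close>. This is one step of polarising \<open>p\<close> to a symmetric multiaffine
  form in \<open>k\<close> variables.
\<close>

definition polar0 :: "nat \<Rightarrow> complex poly \<Rightarrow> complex poly" where
  "polar0 k p = p - smult (1 / of_nat k) (pCons 0 (pderiv p))"

definition polar1 :: "nat \<Rightarrow> complex poly \<Rightarrow> complex poly" where
  "polar1 k p = smult (1 / of_nat k) (pderiv p)"

lemma coeff_polar0: "coeff (polar0 k p) a = (1 - of_nat a / of_nat k) * coeff p a"
  by (cases a) (auto simp: polar0_def coeff_pderiv algebra_simps add_divide_distrib)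

lemma coeff_polar1: "coeff (polar1 k p) a = of_nat (Suc a) / of_nat k * coeff p (Suc a)"
  by (simp add: polar1_def coeff_pderiv)

lemma poly_polar: "k > 0 \<Longrightarrow> of_nat k * (poly (polar0 k p) z + s * poly (polar1 k p) z)
    = of_nat k * poly p z + (s - z) * poly (pderiv p) z"
  by (simp add: polar0_def polar1_def field_simps)

lemma degree_polar0_le: "degree p \<le> Suc k \<Longrightarrow> degree (polar0 (Suc k) p) \<le> k"
proof (rule degree_le, intro allI impI)
  fix i assume p: "degree p \<le> Suc k" and "k < i"
  show "coeff (polar0 (Suc k) p) i = 0"
  proof (cases "i = Suc k")
    case True
    then show ?thesis
      using of_nat_neq_0[of k, where ?'a = complex] by (simp add: coeff_polar0 del: of_nat_Suc)
  next
    case False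
    then show ?thesis
      using p \<open>k < i\<close> by (simp add: coeff_polar0 coeff_eq_0)
  qed
qed

lemma degree_polar1_le: "degree p \<le> Suc k \<Longrightarrow> degree (polar1 (Suc k) p) \<le> k"
  by (rule degree_le) (auto simp: coeff_polar1 coeff_eq_0)

text \<open>
  The weights \<open>1 / (k choose b)\<close> are exactly those that make the pairing compatible with
  polarising one variable on each side and contracting the resulting affine pair by
  \<open>a + b s + c t + d s t \<mapsto> a - d\<close>.
\<close>

lemma pairing_contraction:
  "pairing (Suc k) p q = pairing k (polar0 (Suc k) p) (polar0 (Suc k) q)
     - pairing k (polar1 (Suc k) p) (polar1 (Suc k) q)"
proof -
  let ?n = "of_nat (Suc k) :: complex"
  define c where "c b = (- 1) ^ b * coeff p b * coeff q b / of_nat (Suc k choose b)" for b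
  have n: "?n \<noteq> 0"
    by (rule of_nat_neq_0)
  have 0: "(- 1) ^ b * coeff (polar0 (Suc k) p) b * coeff (polar0 (Suc k) q) b
      / of_nat (k choose b) = (1 - of_nat b / ?n) * c b" if "b \<le> k" for b
  proof -
    have "Suc k * (k choose b) = (Suc k choose b) * (Suc k - b)"
    proof -
      have "(Suc k - b) * (Suc k choose b) = Suc k * (k choose b)"
        using that by (metis binomial_absorb_comp diff_Suc_1)
      then show ?thesis by (simp add: mult.commute)
    qed
    then have "?n * of_nat (k choose b) = of_nat (Suc k choose b) * of_nat (Suc k - b)"
      by (metis of_nat_mult)
    then have e: "?n * of_nat (k choose b) = of_nat (Suc k choose b) * (?n - of_nat b)"
      using that by (simp add: of_nat_diff)
    have nz: "of_nat (k choose b) \<noteq> (0 :: complex)" "of_nat (Suc k choose b) \<noteq> (0 :: complex)"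
      using that by (auto simp del: binomial_Suc_Suc)
    have "(1 - of_nat b / ?n) * (1 - of_nat b / ?n) / of_nat (k choose b)
        = (1 - of_nat b / ?n) / (of_nat (Suc k choose b) :: complex)"
    proof -
      have "1 - of_nat b / ?n = of_nat (k choose b) / of_nat (Suc k choose b)"
        using e n nz by (simp add: field_simps del: of_nat_Suc)
      then show ?thesis using nz by simp
    qed
    then show ?thesis
      by (simp add: coeff_polar0 c_def mult_ac del: of_nat_Suc)
         (metis (no_types, lifting) mult.assoc mult.left_commute times_divide_eq_right)
  qed
  have 1: "(- 1) ^ b * coeff (polar1 (Suc k) p) b * coeff (polar1 (Suc k) q) b
      / of_nat (k choose b) = - (of_nat (Suc b) / ?n * c (Suc b))" if "b \<le> k" for b
  proof -
    have "of_nat (Suc b) * of_nat (Suc k choose Suc b) = ?n * of_nat (k choose b)"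
      by (metis of_nat_mult Suc_times_binomial)
    moreover have nz: "of_nat (k choose b) \<noteq> (0 :: complex)" "of_nat (Suc k choose Suc b) \<noteq> (0 :: complex)"
      using that by (auto simp del: binomial_Suc_Suc)
    ultimately have "of_nat (Suc b) / ?n = of_nat (k choose b) / (of_nat (Suc k choose Suc b) :: complex)"
      using n by (simp add: field_simps del: of_nat_Suc binomial_Suc_Suc)
    then show ?thesis
      using nz by (simp add: coeff_polar1 c_def del: of_nat_Suc binomial_Suc_Suc)
  qed
  have "pairing k (polar0 (Suc k) p) (polar0 (Suc k) q)
      - pairing k (polar1 (Suc k) p) (polar1 (Suc k) q)
      = (\<Sum>b\<le>k. (1 - of_nat b / ?n) * c b) + (\<Sum>b\<le>k. of_nat (Suc b) / ?n * c (Suc b))"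
    unfolding pairing_def using 0 1 by (simp add: sum_negf del: of_nat_Suc)
  also have "(\<Sum>b\<le>k. (1 - of_nat b / ?n) * c b) = (\<Sum>b\<le>Suc k. (1 - of_nat b / ?n) * c b)"
    using n by (simp del: of_nat_Suc)
  also have "(\<Sum>b\<le>k. of_nat (Suc b) / ?n * c (Suc b)) = (\<Sum>b\<le>Suc k. of_nat b / ?n * c b)"
    by (subst sum.atMost_Suc_shift) (simp del: of_nat_Suc)
  also have "(\<Sum>b\<le>Suc k. (1 - of_nat b / ?n) * c b) + (\<Sum>b\<le>Suc k. of_nat b / ?n * c b)
      = (\<Sum>b\<le>Suc k. c b)"
    unfolding sum.distrib[symmetric] by (intro sum.cong) (auto simp: algebra_simps)
  finally show ?thesis
    by (simp add: pairing_def c_def)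
qed

text \<open>
  A bivariate polynomial as a sum of products \<open>p(x) q(y)\<close>. A list is used because a contraction
  step replaces each summand by two, and an induction could not change the type of an index
  set.
\<close>

definition tensor_eval :: "(complex poly \<times> complex poly) list \<Rightarrow> complex \<Rightarrow> complex \<Rightarrow> complex" where
  "tensor_eval ps x y = (\<Sum>(p, q)\<leftarrow>ps. poly p x * poly q y)"

text \<open>
  Laguerre's theorem for a linear combination; the weights are the values of the factors in the
  other variable, which is held fixed.
\<close>

lemma polarize_sum_list:
  fixes f :: "'b \<Rightarrow> complex poly" and w :: "'b \<Rightarrow> complex"
  assumes k: "k > 0" and deg: "\<And>j. j \<in> set js \<Longrightarrow> degree (f j) \<le> k"
    and nz: "\<And>x. norm x < R \<Longrightarrow> (\<Sum>j\<leftarrow>js. w j * poly (f j) x) \<noteq> 0"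
    and z: "norm z < R" and s: "norm s < R"
  shows "(\<Sum>j\<leftarrow>js. w j * (poly (polar0 k (f j)) z + s * poly (polar1 k (f j)) z)) \<noteq> 0"
proof -
  define p where "p = (\<Sum>j\<leftarrow>js. smult (w j) (f j))"
  have P: "poly (\<Sum>j\<leftarrow>js. smult (w j) (f j)) x = (\<Sum>j\<leftarrow>js. w j * poly (f j) x)" for x
    by (induction js) auto
  have P': "poly (pderiv (\<Sum>j\<leftarrow>js. smult (w j) (f j))) x = (\<Sum>j\<leftarrow>js. w j * poly (pderiv (f j)) x)" for x
    by (induction js) (auto simp: pderiv_add pderiv_smult)
  have "degree p \<le> k"
    unfolding p_def using deg
    by (induction js) (auto intro!: degree_add_le order_trans[OF degree_smult_le])
  then have "of_nat k * poly p z + (s - z) * poly (pderiv p) z \<noteq> 0"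
    using laguerre_polar_derivative[of k p R z s] nz z s k by (auto simp: p_def P)
  also have "of_nat k * poly p z + (s - z) * poly (pderiv p) z
      = of_nat k * (\<Sum>j\<leftarrow>js. w j * (poly (polar0 k (f j)) z + s * poly (polar1 k (f j)) z))"
  proof -
    have "of_nat k * poly p z + (s - z) * poly (pderiv p) z
        = (\<Sum>j\<leftarrow>js. w j * (of_nat k * poly (f j) z + (s - z) * poly (pderiv (f j)) z))"
      unfolding p_def P P' by (induction js) (auto simp: algebra_simps)
    also have "\<dots> = (\<Sum>j\<leftarrow>js. of_nat k * (w j * (poly (polar0 k (f j)) z + s * poly (polar1 k (f j)) z)))"
      unfolding poly_polar[OF k, symmetric] by (simp add: mult.left_commute)
    finally show ?thesis
      by (simp add: sum_list_const_mult)
  qed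
  finally show ?thesis
    by auto
qed

text \<open>
  Induction on the degree bound: Laguerre's theorem in \<open>x\<close> and then in \<open>y\<close> polarises the
  polynomial without creating zeros, and Asano's contraction removes the two new variables. What
  remains has degree at most \<open>k - 1\<close> in each variable, the same zero-free region and the same
  pairing. The polynomial need not be a product of a function of \<open>x\<close> and one of \<open>y\<close>; this
  generality is what makes induction on the number of variables possible.
\<close>

theorem bivariate_pairing_nonzero:
  assumes \<rho>: "\<rho> > 1"
    and "\<And>p q. (p, q) \<in> set ps \<Longrightarrow> degree p \<le> k \<and> degree q \<le> k"
    and "\<And>x y. norm x < 1 \<Longrightarrow> norm y < \<rho> \<Longrightarrow> tensor_eval ps x y \<noteq> 0"
  shows "(\<Sum>(p, q)\<leftarrow>ps. pairing k p q) \<noteq> 0"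
  using assms(2,3)
proof (induction k arbitrary: ps)
  case 0
  have "poly p 0 * poly q 0 = pairing 0 p q" for p q
    by (simp add: pairing_def poly_0_coeff_0)
  then have "tensor_eval ps 0 0 = (\<Sum>(p, q)\<leftarrow>ps. pairing 0 p q)"
    by (simp add: tensor_eval_def)
  then show ?case
    using 0(2)[of 0 0] \<rho> by simp
next
  case (Suc k)
  let ?A = "polar0 (Suc k)" and ?B = "polar1 (Suc k)"
  define qs where "qs = map (\<lambda>(p, q). (?A p, ?A q)) ps @ map (\<lambda>(p, q). (- ?B p, ?B q)) ps"
  have "tensor_eval qs x y \<noteq> 0" if x: "norm x < 1" and y: "norm y < \<rho>" for x y
  proof -
    define a where "a = (\<Sum>j\<leftarrow>ps. poly (?A (fst j)) x * poly (?A (snd j)) y)"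
    define b where "b = (\<Sum>j\<leftarrow>ps. poly (?B (fst j)) x * poly (?A (snd j)) y)"
    define c where "c = (\<Sum>j\<leftarrow>ps. poly (?A (fst j)) x * poly (?B (snd j)) y)"
    define d where "d = (\<Sum>j\<leftarrow>ps. poly (?B (fst j)) x * poly (?B (snd j)) y)"
    have "a + b * s + c * t + d * s * t \<noteq> 0" if s: "norm s < 1" and t: "norm t < \<rho>" for s t
    proof -
      have 1: "(\<Sum>j\<leftarrow>ps. poly (snd j) y' * (poly (?A (fst j)) x + s * poly (?B (fst j)) x)) \<noteq> 0"
        if "norm y' < \<rho>" for y'
        using Suc.prems(1) Suc.prems(2)[OF _ that] x s
        by (intro polarize_sum_list[where R = 1])
           (auto simp: tensor_eval_def case_prod_unfold mult.commute)
      have "(\<Sum>j\<leftarrow>ps. (poly (?A (fst j)) x + s * poly (?B (fst j)) x)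
          * (poly (?A (snd j)) y + t * poly (?B (snd j)) y)) \<noteq> 0"
        using Suc.prems(1) 1 y t
        by (intro polarize_sum_list[where R = \<rho>]) (auto simp: mult.commute)
      also have "(\<Sum>j\<leftarrow>ps. (poly (?A (fst j)) x + s * poly (?B (fst j)) x)
          * (poly (?A (snd j)) y + t * poly (?B (snd j)) y)) = a + b * s + c * t + d * s * t"
        unfolding a_def b_def c_def d_def by (induction ps) (auto simp: algebra_simps)
      finally show ?thesis .
    qed
    then have "a \<noteq> d"
      using asano_contraction[OF \<rho>] by blast
    moreover have "tensor_eval qs x y = a - d"
      by (simp add: tensor_eval_def qs_def a_def d_def o_def case_prod_unfold uminus_sum_list_map)
    ultimately show ?thesis by simp
  qed
  moreover have "degree p \<le> k \<and> degree q \<le> k" if "(p, q) \<in> set qs" for p q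
    using that Suc.prems(1) by (auto simp: qs_def intro!: degree_polar0_le degree_polar1_le)
  ultimately have "(\<Sum>(p, q)\<leftarrow>qs. pairing k p q) \<noteq> 0"
    by (rule Suc.IH[rotated])
  also have "(\<Sum>(p, q)\<leftarrow>qs. pairing k p q) = (\<Sum>(p, q)\<leftarrow>ps. pairing (Suc k) p q)"
  proof -
    have "pairing k (- p) q = - pairing k p q" for p q
      by (simp add: pairing_def sum_negf)
    then show ?thesis
      unfolding qs_def by (induction ps) (auto simp: pairing_contraction)
  qed
  finally show ?case .
qed

section \<open>Pairing off several variables\<close>

abbreviation exps :: "'i set \<Rightarrow> ('i \<Rightarrow> nat) \<Rightarrow> ('i \<Rightarrow> nat) set" where
  "exps I \<kappa> \<equiv> \<Pi>\<^sub>E i\<in>I. {..\<kappa> i}"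

lemma finite_exps: "finite I \<Longrightarrow> finite (exps I \<kappa>)"
  by (intro finite_PiE) auto

lemma sum_PiE_insert:
  assumes "j \<notin> I"
  shows "(\<Sum>\<alpha>\<in>PiE (insert j I) S. \<phi> \<alpha>) = (\<Sum>a\<in>S j. \<Sum>\<alpha>\<in>PiE I S. \<phi> (\<alpha>(j := a)))"
proof -
  have "inj_on (\<lambda>(y, g). g(j := y)) (S j \<times> PiE I S)"
    using assms by (rule inj_combinator)
  then show ?thesis
    unfolding PiE_insert_eq by (simp add: sum.reindex sum.cartesian_product case_prod_unfold)
qed

text \<open>
  Splits one coordinate off a weighted sum over pairs of exponents. It is applied to evaluation
  and to the pairing, which have the same shape.
\<close>

lemma sum_exps_square_insert:
  fixes h :: "('i \<Rightarrow> nat) \<Rightarrow> ('i \<Rightarrow> nat) \<Rightarrow> complex"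
  assumes "finite I" "j \<notin> I"
  shows "(\<Sum>\<alpha>\<in>exps (insert j I) \<kappa>. \<Sum>\<beta>\<in>exps (insert j I) \<kappa>. h \<alpha> \<beta> * (\<Prod>i\<in>insert j I. W i (\<alpha> i) (\<beta> i)))
    = (\<Sum>\<alpha>\<in>exps I \<kappa>. \<Sum>\<beta>\<in>exps I \<kappa>. (\<Sum>a\<le>\<kappa> j. \<Sum>b\<le>\<kappa> j. h (\<alpha>(j := a)) (\<beta>(j := b)) * W j a b)
        * (\<Prod>i\<in>I. W i (\<alpha> i) (\<beta> i)))"
proof -
  have W: "(\<Prod>i\<in>insert j I. W i ((\<alpha>(j := a)) i) ((\<beta>(j := b)) i)) = W j a b * (\<Prod>i\<in>I. W i (\<alpha> i) (\<beta> i))"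
    for \<alpha> \<beta> a b
  proof -
    have "(\<Prod>i\<in>I. W i ((\<alpha>(j := a)) i) ((\<beta>(j := b)) i)) = (\<Prod>i\<in>I. W i (\<alpha> i) (\<beta> i))"
      using assms by (intro prod.cong) auto
    then show ?thesis
      using assms by simp
  qed
  have "(\<Sum>\<alpha>\<in>exps (insert j I) \<kappa>. \<Sum>\<beta>\<in>exps (insert j I) \<kappa>. h \<alpha> \<beta> * (\<Prod>i\<in>insert j I. W i (\<alpha> i) (\<beta> i)))
      = (\<Sum>a\<le>\<kappa> j. \<Sum>\<alpha>\<in>exps I \<kappa>. \<Sum>b\<le>\<kappa> j. \<Sum>\<beta>\<in>exps I \<kappa>. h (\<alpha>(j := a)) (\<beta>(j := b))
          * (W j a b * (\<Prod>i\<in>I. W i (\<alpha> i) (\<beta> i))))"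
    by (simp only: sum_PiE_insert[OF assms(2)] W)
  also have "\<dots> = (\<Sum>\<alpha>\<in>exps I \<kappa>. \<Sum>a\<le>\<kappa> j. \<Sum>\<beta>\<in>exps I \<kappa>. \<Sum>b\<le>\<kappa> j. h (\<alpha>(j := a)) (\<beta>(j := b))
          * (W j a b * (\<Prod>i\<in>I. W i (\<alpha> i) (\<beta> i))))"
    by (subst sum.swap, intro sum.cong refl, rule sum.swap)
  also have "\<dots> = (\<Sum>\<alpha>\<in>exps I \<kappa>. \<Sum>\<beta>\<in>exps I \<kappa>. \<Sum>a\<le>\<kappa> j. \<Sum>b\<le>\<kappa> j. h (\<alpha>(j := a)) (\<beta>(j := b))
          * (W j a b * (\<Prod>i\<in>I. W i (\<alpha> i) (\<beta> i))))"
    by (intro sum.cong refl, rule sum.swap)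
  finally show ?thesis
    by (simp only: sum_distrib_right mult.assoc)
qed

lemma sum_exps_square_swap:
  fixes h :: "('i \<Rightarrow> nat) \<Rightarrow> ('i \<Rightarrow> nat) \<Rightarrow> complex"
  shows "(\<Sum>\<alpha>\<in>A. \<Sum>\<beta>\<in>B. (\<Sum>a\<in>A'. \<Sum>b\<in>B'. h (\<alpha>(j := a)) (\<beta>(j := b)) * w a b) * W \<alpha> \<beta>)
    = (\<Sum>a\<in>A'. \<Sum>b\<in>B'. (\<Sum>\<alpha>\<in>A. \<Sum>\<beta>\<in>B. h (\<alpha>(j := a)) (\<beta>(j := b)) * W \<alpha> \<beta>) * w a b)"
proof -
  have "(\<Sum>\<alpha>\<in>A. \<Sum>\<beta>\<in>B. (\<Sum>a\<in>A'. \<Sum>b\<in>B'. h (\<alpha>(j := a)) (\<beta>(j := b)) * w a b) * W \<alpha> \<beta>)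
     = (\<Sum>(\<alpha>, \<beta>)\<in>A \<times> B. \<Sum>(a, b)\<in>A' \<times> B'. h (\<alpha>(j := a)) (\<beta>(j := b)) * w a b * W \<alpha> \<beta>)"
    by (simp add: sum.cartesian_product[symmetric] sum_distrib_right)
  also have "\<dots> = (\<Sum>(a, b)\<in>A' \<times> B'. \<Sum>(\<alpha>, \<beta>)\<in>A \<times> B. h (\<alpha>(j := a)) (\<beta>(j := b)) * W \<alpha> \<beta> * w a b)"
    unfolding case_prod_unfold by (subst sum.swap) (simp only: mult_ac)
  also have "\<dots> = (\<Sum>a\<in>A'. \<Sum>b\<in>B'. (\<Sum>\<alpha>\<in>A. \<Sum>\<beta>\<in>B. h (\<alpha>(j := a)) (\<beta>(j := b)) * W \<alpha> \<beta>) * w a b)"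
    by (simp add: sum.cartesian_product[symmetric] sum_distrib_right)
  finally show ?thesis .
qed

text \<open>
  Induction on the set of variables. For fixed values \<open>x\<close>, \<open>y\<close> of the new pair of variables the
  induction hypothesis shows that pairing off all other variables gives a nonzero number; as a
  function of \<open>x\<close> and \<open>y\<close> this number is a bivariate polynomial, to which the bivariate case
  applies. The tensor \<open>h\<close> is arbitrary since the bivariate polynomial that arises is not a
  product even when \<open>h\<close> is.
\<close>

theorem multivariate_pairing_nonzero:
  fixes P Q :: "'i \<Rightarrow> nat \<Rightarrow> complex poly" and h :: "('i \<Rightarrow> nat) \<Rightarrow> ('i \<Rightarrow> nat) \<Rightarrow> complex"
  assumes "finite I" and \<rho>: "\<rho> > 1"
    and deg: "\<And>i k. k \<le> \<kappa> i \<Longrightarrow> degree (P i k) \<le> \<kappa> i" "\<And>i k. k \<le> \<kappa> i \<Longrightarrow> degree (Q i k) \<le> \<kappa> i"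
    and nz: "\<And>z u. \<forall>i\<in>I. norm (z i) < 1 \<Longrightarrow> \<forall>i\<in>I. norm (u i) < \<rho> \<Longrightarrow>
      (\<Sum>\<alpha>\<in>exps I \<kappa>. \<Sum>\<beta>\<in>exps I \<kappa>. h \<alpha> \<beta> *
        (\<Prod>i\<in>I. poly (P i (\<alpha> i)) (z i) * poly (Q i (\<beta> i)) (u i))) \<noteq> 0"
  shows "(\<Sum>\<alpha>\<in>exps I \<kappa>. \<Sum>\<beta>\<in>exps I \<kappa>. h \<alpha> \<beta> *
    (\<Prod>i\<in>I. pairing (\<kappa> i) (P i (\<alpha> i)) (Q i (\<beta> i)))) \<noteq> 0"
  using assms(1) nz
proof (induction I arbitrary: h rule: finite_induct)
  case empty
  then show ?case by simp
next
  case (insert j I)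
  define k where "k a b = (\<Sum>\<alpha>\<in>exps I \<kappa>. \<Sum>\<beta>\<in>exps I \<kappa>. h (\<alpha>(j := a)) (\<beta>(j := b)) *
    (\<Prod>i\<in>I. pairing (\<kappa> i) (P i (\<alpha> i)) (Q i (\<beta> i))))" for a b
  define ps where "ps = map (\<lambda>(a, b). (smult (k a b) (P j a), Q j b))
    (List.product [0..<Suc (\<kappa> j)] [0..<Suc (\<kappa> j)])"
  have ps_sum: "(\<Sum>(p, q)\<leftarrow>ps. \<phi> p q) = (\<Sum>a\<le>\<kappa> j. \<Sum>b\<le>\<kappa> j. \<phi> (smult (k a b) (P j a)) (Q j b))"
    for \<phi> :: "complex poly \<Rightarrow> complex poly \<Rightarrow> complex"
  proof -
    have "(\<Sum>(p, q)\<leftarrow>ps. \<phi> p q) = (\<Sum>(a, b)\<leftarrow>List.product [0..<Suc (\<kappa> j)] [0..<Suc (\<kappa> j)].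
        \<phi> (smult (k a b) (P j a)) (Q j b))"
      unfolding ps_def by (simp only: map_map o_def case_prod_unfold fst_conv snd_conv)
    also have "\<dots> = (\<Sum>(a, b)\<in>{..\<kappa> j} \<times> {..\<kappa> j}. \<phi> (smult (k a b) (P j a)) (Q j b))"
      by (subst sum.distinct_set_conv_list[symmetric]) (simp_all add: distinct_product atLeast0LessThan lessThan_Suc_atMost del: upt_Suc)
    finally show ?thesis
      by (simp add: sum.cartesian_product)
  qed
  have "tensor_eval ps x y \<noteq> 0" if x: "norm x < 1" and y: "norm y < \<rho>" for x y
  proof -
    have "(\<Sum>\<alpha>\<in>exps I \<kappa>. \<Sum>\<beta>\<in>exps I \<kappa>.
        (\<Sum>a\<le>\<kappa> j. \<Sum>b\<le>\<kappa> j. h (\<alpha>(j := a)) (\<beta>(j := b)) * (poly (P j a) x * poly (Q j b) y)) *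
        (\<Prod>i\<in>I. pairing (\<kappa> i) (P i (\<alpha> i)) (Q i (\<beta> i)))) \<noteq> 0"
    proof (rule insert.IH)
      fix z u :: "'i \<Rightarrow> complex"
      assume z: "\<forall>i\<in>I. norm (z i) < 1" and u: "\<forall>i\<in>I. norm (u i) < \<rho>"
      have "(\<Sum>\<alpha>\<in>exps (insert j I) \<kappa>. \<Sum>\<beta>\<in>exps (insert j I) \<kappa>. h \<alpha> \<beta> *
          (\<Prod>i\<in>insert j I. poly (P i (\<alpha> i)) ((z(j := x)) i) * poly (Q i (\<beta> i)) ((u(j := y)) i))) \<noteq> 0"
        using z u x y by (intro insert.prems) auto
      also have "(\<Sum>\<alpha>\<in>exps (insert j I) \<kappa>. \<Sum>\<beta>\<in>exps (insert j I) \<kappa>. h \<alpha> \<beta> *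
          (\<Prod>i\<in>insert j I. poly (P i (\<alpha> i)) ((z(j := x)) i) * poly (Q i (\<beta> i)) ((u(j := y)) i)))
        = (\<Sum>\<alpha>\<in>exps I \<kappa>. \<Sum>\<beta>\<in>exps I \<kappa>.
          (\<Sum>a\<le>\<kappa> j. \<Sum>b\<le>\<kappa> j. h (\<alpha>(j := a)) (\<beta>(j := b)) *
            (poly (P j a) ((z(j := x)) j) * poly (Q j b) ((u(j := y)) j))) *
          (\<Prod>i\<in>I. poly (P i (\<alpha> i)) ((z(j := x)) i) * poly (Q i (\<beta> i)) ((u(j := y)) i)))"
        using insert.hyps by (rule sum_exps_square_insert)
      also have "\<dots> = (\<Sum>\<alpha>\<in>exps I \<kappa>. \<Sum>\<beta>\<in>exps I \<kappa>.
          (\<Sum>a\<le>\<kappa> j. \<Sum>b\<le>\<kappa> j. h (\<alpha>(j := a)) (\<beta>(j := b)) * (poly (P j a) x * poly (Q j b) y)) *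
          (\<Prod>i\<in>I. poly (P i (\<alpha> i)) (z i) * poly (Q i (\<beta> i)) (u i)))"
        using insert.hyps by (intro sum.cong refl arg_cong2[where f = "(*)"] prod.cong) auto
      finally show "\<dots> \<noteq> 0" .
    qed
    also have "(\<Sum>\<alpha>\<in>exps I \<kappa>. \<Sum>\<beta>\<in>exps I \<kappa>.
        (\<Sum>a\<le>\<kappa> j. \<Sum>b\<le>\<kappa> j. h (\<alpha>(j := a)) (\<beta>(j := b)) * (poly (P j a) x * poly (Q j b) y)) *
        (\<Prod>i\<in>I. pairing (\<kappa> i) (P i (\<alpha> i)) (Q i (\<beta> i))))
      = (\<Sum>a\<le>\<kappa> j. \<Sum>b\<le>\<kappa> j. k a b * (poly (P j a) x * poly (Q j b) y))"
      unfolding k_def by (rule sum_exps_square_swap)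
    also have "\<dots> = tensor_eval ps x y"
      unfolding tensor_eval_def ps_sum by (simp add: mult.assoc)
    finally show ?thesis .
  qed
  moreover have "degree p \<le> \<kappa> j \<and> degree q \<le> \<kappa> j" if "(p, q) \<in> set ps" for p q
    using that deg by (auto simp: ps_def intro!: order_trans[OF degree_smult_le])
  ultimately have "(\<Sum>(p, q)\<leftarrow>ps. pairing (\<kappa> j) p q) \<noteq> 0"
    by (rule bivariate_pairing_nonzero[OF \<rho>, rotated])
  also have "(\<Sum>(p, q)\<leftarrow>ps. pairing (\<kappa> j) p q) = (\<Sum>a\<le>\<kappa> j. \<Sum>b\<le>\<kappa> j. k a b * pairing (\<kappa> j) (P j a) (Q j b))"
    unfolding ps_sum by (simp add: pairing_def sum_distrib_left mult_ac)
  also have "\<dots> = (\<Sum>\<alpha>\<in>exps (insert j I) \<kappa>. \<Sum>\<beta>\<in>exps (insert j I) \<kappa>. h \<alpha> \<beta> *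
      (\<Prod>i\<in>insert j I. pairing (\<kappa> i) (P i (\<alpha> i)) (Q i (\<beta> i))))"
    unfolding k_def
      sum_exps_square_insert[OF insert.hyps, where W = "\<lambda>i a b. pairing (\<kappa> i) (P i a) (Q i b)"]
    by (rule sum_exps_square_swap[symmetric])
  finally show ?case .
qed

section \<open>Multivariate polynomials in arbitrary bases\<close>

text \<open>
  A multivariate polynomial in which the monomial \<open>z\<^sub>i\<^sup>k\<close> is replaced by an arbitrary polynomial
  \<open>P i k\<close>, so that a change of coordinates leaves the coefficients \<open>f\<close> untouched.
\<close>

definition basis_eval :: "'i set \<Rightarrow> ('i \<Rightarrow> nat) \<Rightarrow> ('i \<Rightarrow> nat \<Rightarrow> complex poly)
    \<Rightarrow> (('i \<Rightarrow> nat) \<Rightarrow> complex) \<Rightarrow> ('i \<Rightarrow> complex) \<Rightarrow> complex" where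
  "basis_eval I \<kappa> P f z = (\<Sum>\<alpha>\<in>exps I \<kappa>. f \<alpha> * (\<Prod>i\<in>I. poly (P i (\<alpha> i)) (z i)))"

lemma basis_eval_cong: "(\<And>i. i \<in> I \<Longrightarrow> z i = z' i) \<Longrightarrow> basis_eval I \<kappa> P f z = basis_eval I \<kappa> P f z'"
  by (simp add: basis_eval_def)

lemma continuous_on_basis_eval: "continuous_on A (basis_eval I \<kappa> P f)"
  unfolding basis_eval_def[abs_def]
  by (intro continuous_intros continuous_on_subset[OF continuous_on_product_coordinates]) auto

lemma tendsto_basis_eval:
  "(\<And>i. i \<in> I \<Longrightarrow> ((\<lambda>t. Z t i) \<longlongrightarrow> z i) F) \<Longrightarrow>
    ((\<lambda>t. basis_eval I \<kappa> P f (Z t)) \<longlongrightarrow> basis_eval I \<kappa> P f z) F"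
  unfolding basis_eval_def by (intro tendsto_sum tendsto_mult tendsto_const tendsto_prod tendsto_poly) auto

text \<open>
  The function \<open>m\<close> below measures how far a point lies outside the closed polydisc. It attains a
  positive minimum on the compact set of zeros of bounded modulus.
\<close>

lemma nonvanishing_polydisc_fatten:
  fixes P :: "'i \<Rightarrow> nat \<Rightarrow> complex poly"
  assumes I: "finite I"
    and nz: "\<And>u. \<forall>i\<in>I. norm (u i) \<le> 1 \<Longrightarrow> basis_eval I \<kappa> P f u \<noteq> 0"
  shows "\<exists>\<rho>>1. \<forall>u. (\<forall>i\<in>I. norm (u i) < \<rho>) \<longrightarrow> basis_eval I \<kappa> P f u \<noteq> 0"
proof -
  \<comment> \<open>Coordinates outside \<open>I\<close> are pinned to \<open>0\<close>, which makes \<open>K\<close> compact in the product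
    topology on all functions.\<close>
  define K where "K = (\<Pi>\<^sub>E i\<in>UNIV. if i \<in> I then cball (0::complex) 2 else {0})"
  define Z where "Z = K \<inter> {u. basis_eval I \<kappa> P f u = 0}"
  define m where "m u = (\<Sum>i\<in>I. max 0 (norm (u i) - 1))" for u :: "'i \<Rightarrow> complex"
  have "compactin (product_topology (\<lambda>i. euclidean) UNIV) K"
    unfolding K_def by (subst compactin_PiE) auto
  then have "compact K"
    by (simp add: euclidean_product_topology)
  moreover have "closed {u. basis_eval I \<kappa> P f u = 0}"
    by (intro closed_Collect_eq continuous_on_basis_eval continuous_on_const)
  ultimately have Z: "compact Z"
    unfolding Z_def by (rule compact_Int_closed)
  have m: "continuous_on Z m"
    unfolding m_def
    by (intro continuous_intros continuous_on_subset[OF continuous_on_product_coordinates]) auto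
  have to_Z: "\<exists>v\<in>Z. m v = m u"
    if "\<forall>i\<in>I. norm (u i) < 2" "basis_eval I \<kappa> P f u = 0" for u
  proof
    let ?v = "\<lambda>i. if i \<in> I then u i else 0"
    show "m ?v = m u"
      by (simp add: m_def)
    have "basis_eval I \<kappa> P f ?v = basis_eval I \<kappa> P f u"
      by (rule basis_eval_cong) simp
    then show "?v \<in> Z"
      using that by (auto simp: Z_def K_def less_imp_le)
  qed
  show ?thesis
  proof (cases "Z = {}")
    case True
    then show ?thesis
      using to_Z by (intro exI[of _ 2]) auto
  next
    case False
    then obtain u where u: "u \<in> Z" "\<And>v. v \<in> Z \<Longrightarrow> m u \<le> m v"
      using continuous_attains_inf[OF Z _ m] by blast
    obtain i where i: "i \<in> I" "norm (u i) > 1"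
      using nz[of u] u(1) by (force simp: Z_def)
    have "max 0 (norm (u i) - 1) \<le> m u"
      unfolding m_def using i I by (intro member_le_sum) auto
    then have mu: "m u > 0"
      using i by simp
    \<comment> \<open>With this choice the excesses over \<open>1\<close> of all coordinates add up to less than the minimum
      \<open>m u\<close>.\<close>
    define \<rho> where "\<rho> = min 2 (1 + m u / (real (card I) + 1))"
    have "basis_eval I \<kappa> P f w \<noteq> 0" if w: "\<forall>i\<in>I. norm (w i) < \<rho>" for w
    proof
      assume "basis_eval I \<kappa> P f w = 0"
      then obtain v where "v \<in> Z" "m v = m w"
        using to_Z[of w] w by (auto simp: \<rho>_def)
      then have "m u \<le> m w"
        using u(2) by metis
      also have "m w \<le> real (card I) * (m u / (real (card I) + 1))"
        unfolding m_def[of w] using w mu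
        by (intro sum_bounded_above) (auto simp: \<rho>_def intro!: divide_nonneg_nonneg)
      also have "\<dots> < m u"
        using mu by (simp add: field_simps)
      finally show False by simp
    qed
    moreover have "\<rho> > 1"
      using mu by (simp add: \<rho>_def add_nonneg_pos)
    ultimately show ?thesis by blast
  qed
qed

lemma nonzero_on_infinite_grid:
  fixes f :: "('i \<Rightarrow> nat) \<Rightarrow> complex"
  assumes "finite I" and inf: "\<And>i. i \<in> I \<Longrightarrow> infinite (S i)"
    and "\<alpha> \<in> exps I \<kappa>" "f \<alpha> \<noteq> 0"
  shows "\<exists>x. (\<forall>i\<in>I. x i \<in> S i) \<and> (\<Sum>\<alpha>\<in>exps I \<kappa>. f \<alpha> * (\<Prod>i\<in>I. x i ^ \<alpha> i)) \<noteq> 0"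
  using assms
proof (induction I arbitrary: f \<alpha> rule: finite_induct)
  case empty
  then show ?case by simp
next
  case (insert j I)
  define E where "E x b = (\<Sum>\<alpha>\<in>exps I \<kappa>. f (\<alpha>(j := b)) * (\<Prod>i\<in>I. x i ^ \<alpha> i))" for x b
  have "\<exists>x. (\<forall>i\<in>I. x i \<in> S i) \<and> (\<Sum>\<alpha>'\<in>exps I \<kappa>. f (\<alpha>'(j := \<alpha> j)) * (\<Prod>i\<in>I. x i ^ \<alpha>' i)) \<noteq> 0"
  proof (rule insert.IH)
    show "\<alpha>(j := undefined) \<in> exps I \<kappa>"
      using insert.prems(2) insert.hyps by (auto simp: PiE_iff extensional_def)
    show "f ((\<alpha>(j := undefined))(j := \<alpha> j)) \<noteq> 0"
      using insert.prems(3) by simp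
  qed (use insert.prems in auto)
  then obtain x where x: "\<forall>i\<in>I. x i \<in> S i" "E x (\<alpha> j) \<noteq> 0"
    unfolding E_def by blast
  define q where "q = (\<Sum>b\<le>\<kappa> j. monom (E x b) b)"
  have "coeff q (\<alpha> j) = E x (\<alpha> j)"
    using insert.prems(2) by (auto simp: q_def coeff_sum PiE_iff)
  then have "finite {y. poly q y = 0}"
    using x(2) by (intro poly_roots_finite) auto
  then have "\<not> S j \<subseteq> {y. poly q y = 0}"
    using insert.prems(1)[of j] finite_subset by auto
  then obtain y where y: "y \<in> S j" "poly q y \<noteq> 0"
    by blast
  have "(\<Sum>\<alpha>\<in>exps (insert j I) \<kappa>. f \<alpha> * (\<Prod>i\<in>insert j I. (x(j := y)) i ^ \<alpha> i))
      = (\<Sum>b\<le>\<kappa> j. \<Sum>\<alpha>\<in>exps I \<kappa>. f (\<alpha>(j := b)) * (y ^ b * (\<Prod>i\<in>I. x i ^ \<alpha> i)))"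
    unfolding sum_PiE_insert[OF insert.hyps(2)]
  proof (intro sum.cong refl)
    fix b \<beta>
    have "(\<Prod>i\<in>I. (x(j := y)) i ^ (\<beta>(j := b)) i) = (\<Prod>i\<in>I. x i ^ \<beta> i)"
      using insert.hyps by (intro prod.cong) auto
    then show "f (\<beta>(j := b)) * (\<Prod>i\<in>insert j I. (x(j := y)) i ^ (\<beta>(j := b)) i)
        = f (\<beta>(j := b)) * (y ^ b * (\<Prod>i\<in>I. x i ^ \<beta> i))"
      using insert.hyps by simp
  qed
  also have "\<dots> = poly q y"
    by (simp add: q_def E_def poly_sum poly_monom sum_distrib_left sum_distrib_right mult_ac)
  finally show ?case
    using x(1) y insert.hyps by (intro exI[of _ "x(j := y)"]) auto
qed

section \<open>Charts of the Riemann sphere\<close>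

text \<open>
  The monomial \<open>x\<^sup>k\<close>, seen in a coordinate \<open>w\<close> of the Riemann sphere that is centred at \<open>c\<close>
  (\<open>x = c + r w\<close>) or at infinity (\<open>x = c + r / w\<close>). In the second case it is multiplied by \<open>w\<^sup>K\<close>
  to remain a polynomial; its value at \<open>w = 0\<close> then detects the degree \<open>K\<close>.
\<close>

definition chart_poly :: "bool \<Rightarrow> complex \<Rightarrow> complex \<Rightarrow> nat \<Rightarrow> nat \<Rightarrow> complex poly" where
  "chart_poly fin c r K k = (if fin then [:c, r:] ^ k else [:r, c:] ^ k * monom 1 (K - k))"

definition chart_point :: "bool \<Rightarrow> complex \<Rightarrow> complex \<Rightarrow> complex \<Rightarrow> complex" where
  "chart_point fin c r w = (if fin then c + r * w else c + r / w)"

lemma poly_chart_poly: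
  assumes "k \<le> K" "fin \<or> w \<noteq> 0"
  shows "poly (chart_poly fin c r K k) w = (if fin then 1 else w ^ K) * chart_point fin c r w ^ k"
proof (cases fin)
  case True
  then show ?thesis by (simp add: chart_poly_def chart_point_def mult.commute)
next
  case False
  then have w: "w \<noteq> 0" using assms(2) by simp
  have "(r + w * c) ^ k * w ^ (K - k) = (w * (c + r / w)) ^ k * w ^ (K - k)"
    using w by (simp add: distrib_left add.commute)
  also have "\<dots> = (w ^ k * w ^ (K - k)) * (c + r / w) ^ k"
    by (simp add: power_mult_distrib mult_ac)
  also have "w ^ k * w ^ (K - k) = w ^ K"
    using assms(1) by (simp flip: power_add)
  finally show ?thesis
    using False by (simp add: chart_poly_def chart_point_def poly_monom)
qed

lemma poly_chart_poly_0:
  "k \<le> K \<Longrightarrow> poly (chart_poly False c r K k) 0 = (if k = K then r ^ K else 0)"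
  by (auto simp: chart_poly_def poly_monom)

lemma degree_linear_power_le: "degree ([:a, b:] ^ k) \<le> k" for a b :: complex
proof -
  have "degree [:a, b:] * k \<le> 1 * k"
    by (intro mult_right_mono) auto
  then show ?thesis
    using degree_power_le[of "[:a, b:]" k] by linarith
qed

lemma degree_chart_poly_le:
  assumes "k \<le> K"
  shows "degree (chart_poly fin c r K k) \<le> K"
proof (cases fin)
  case True
  then show ?thesis
    using degree_linear_power_le[of c r k] assms by (simp add: chart_poly_def)
next
  case False
  have "degree ([:r, c:] ^ k * monom 1 (K - k)) \<le> k + (K - k)"
    using degree_linear_power_le[of r c k]
    by (intro order_trans[OF degree_mult_le] add_mono) (auto simp: degree_monom_eq)
  then show ?thesis
    using False assms by (simp add: chart_poly_def)
qed

text \<open>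
  The restriction of a multivariate polynomial to the polynomial curve \<open>t \<mapsto> R\<^sub>i(t)\<close>; used for
  lines and for coordinate slices.
\<close>

definition subst_poly :: "'i set \<Rightarrow> ('i \<Rightarrow> nat) \<Rightarrow> ('i \<Rightarrow> nat \<Rightarrow> complex poly)
    \<Rightarrow> (('i \<Rightarrow> nat) \<Rightarrow> complex) \<Rightarrow> ('i \<Rightarrow> complex poly) \<Rightarrow> complex poly" where
  "subst_poly I \<kappa> P f R = (\<Sum>\<alpha>\<in>exps I \<kappa>. smult (f \<alpha>) (\<Prod>i\<in>I. pcompose (P i (\<alpha> i)) (R i)))"

lemma poly_subst_poly: "poly (subst_poly I \<kappa> P f R) t = basis_eval I \<kappa> P f (\<lambda>i. poly (R i) t)"
  by (simp add: subst_poly_def basis_eval_def poly_sum poly_prod poly_pcompose)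

lemma degree_slice_le:
  assumes "finite I" "i \<in> I" and deg: "\<And>i k. k \<le> \<kappa> i \<Longrightarrow> degree (P i k) \<le> \<kappa> i"
  shows "degree (subst_poly I \<kappa> P f (\<lambda>j. if j = i then [:0, 1:] else [:z j:])) \<le> \<kappa> i"
  unfolding subst_poly_def
proof (rule degree_sum_le[OF finite_exps[OF assms(1)]], rule order_trans[OF degree_smult_le])
  fix \<alpha> assume \<alpha>: "\<alpha> \<in> exps I \<kappa>"
  let ?R = "\<lambda>j. if j = i then [:0, 1:] else [:z j:]"
  have "degree (\<Prod>j\<in>I. pcompose (P j (\<alpha> j)) (?R j)) \<le> (\<Sum>j\<in>I. degree (pcompose (P j (\<alpha> j)) (?R j)))"
    using degree_prod_sum_le[OF assms(1)] by (simp add: o_def)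
  also have "\<dots> \<le> (\<Sum>j\<in>I. if j = i then \<kappa> i else 0)"
    using \<alpha> deg by (intro sum_mono) (auto simp: PiE_iff degree_pcompose)
  also have "\<dots> = \<kappa> i"
    using assms by simp
  finally show "degree (\<Prod>j\<in>I. pcompose (P j (\<alpha> j)) (?R j)) \<le> \<kappa> i" .
qed

lemma pairing_commute: "pairing k p q = pairing k q p"
  by (simp add: pairing_def mult_ac)

text \<open>
  This is the invariance of the bracket under affine maps: for \<open>k + l < K\<close> the two
  supports are disjoint, and otherwise the sum is a multiple of the alternating sum of the binomial
  coefficients of \<open>k + l - K\<close>, which vanishes unless \<open>k + l = K\<close>. Opposite charts
  are needed because the pairing expects one argument reversed.
\<close>

lemma pairing_charts:
  assumes k: "k \<le> K" and l: "l \<le> K"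
  shows "pairing K (chart_poly True c r K k) (chart_poly False c r K l) =
    (if k + l = K then (- 1) ^ k * r ^ K * fact k * fact l / fact K else 0)"
proof -
  let ?T = "\<lambda>b. (- 1) ^ b * coeff (chart_poly True c r K k) b * coeff (chart_poly False c r K l) b
    / of_nat (K choose b)"
  have cT: "coeff (chart_poly True c r K k) b = of_nat (k choose b) * r ^ b * c ^ (k - b)" for b
  proof (cases "b \<le> k")
    case False
    then show ?thesis
      using degree_linear_power_le[of c r k] by (simp add: chart_poly_def coeff_eq_0)
  qed (simp add: chart_poly_def coeff_linear_poly_power)
  have cF: "coeff (chart_poly False c r K l) b =
      (if b < K - l then 0 else of_nat (l choose (K - b)) * r ^ (K - b) * c ^ (b - (K - l)))"
    if "b \<le> K" for b
  proof (cases "b < K - l")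
    case False
    then have "l - (b - (K - l)) = K - b" "b - (K - l) \<le> l"
      using l that by auto
    moreover have "l choose (b - (K - l)) = l choose (K - b)"
      using calculation binomial_symmetric[of "b - (K - l)" l] by simp
    ultimately show ?thesis
      using False by (simp add: chart_poly_def coeff_monom_mult coeff_linear_poly_power mult.commute[of _ "monom _ _"] mult_ac)
  qed (simp add: chart_poly_def coeff_monom_mult mult.commute[of _ "monom _ _"])
  show ?thesis
  proof (cases "k + l < K")
    case True
    have "?T b = 0" if "b \<le> K" for b
      using True that by (cases "b < K - l") (auto simp: cT cF)
    then have "pairing K (chart_poly True c r K k) (chart_poly False c r K l) = 0"
      unfolding pairing_def by (intro sum.neutral) auto
    then show ?thesis
      using True by simp
  next
    case False
    define N where "N = k + l - K"
    define m where "m = K - l"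
    have N: "k = m + N" "l = K - m" "m + N \<le> K"
      using False k l by (auto simp: N_def m_def)
    have "pairing K (chart_poly True c r K k) (chart_poly False c r K l) = (\<Sum>b\<in>{m..m + N}. ?T b)"
      unfolding pairing_def
    proof (intro sum.mono_neutral_right ballI)
      fix b assume b: "b \<in> {..K} - {m..m + N}"
      have "coeff (chart_poly True c r K k) b = 0 \<or> coeff (chart_poly False c r K l) b = 0"
      proof (cases "b < m")
        case True
        then show ?thesis
          using b by (auto simp: cF m_def)
      next
        case False
        then show ?thesis
          using b N(1) cT[of b] by auto
      qed
      then show "?T b = 0"
        by auto
    qed (use N in auto)
    also have "\<dots> = (\<Sum>j\<le>N. ?T (m + j))"
      by (rule sum.reindex_bij_witness[of _ "\<lambda>j. m + j" "\<lambda>b. b - m"]) auto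
    also have "\<dots> = (\<Sum>j\<le>N. ((- 1) ^ m * r ^ K * c ^ N * fact k * fact l / (fact K * fact N)) *
        ((- 1) ^ j * of_nat (N choose j)))"
    proof (intro sum.cong refl)
      fix j assume "j \<in> {..N}"
      then have j: "j \<le> N" by simp
      have 1: "of_nat (k choose (m + j)) = (fact k / (fact (m + j) * fact (N - j)) :: complex)"
        using j N by (subst binomial_fact) auto
      have 2: "of_nat (l choose (K - (m + j))) = (fact l / (fact (K - (m + j)) * fact j) :: complex)"
        using j N by (subst binomial_fact) auto
      have 3: "of_nat (K choose (m + j)) = (fact K / (fact (m + j) * fact (K - (m + j))) :: complex)"
        using j N by (subst binomial_fact) auto
      have 4: "of_nat (N choose j) = (fact N / (fact j * fact (N - j)) :: complex)"
        using j by (subst binomial_fact) auto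
      have p: "r ^ (m + j) * r ^ (K - (m + j)) = r ^ K" "c ^ (N - j) * c ^ j = c ^ N"
        using j N by (simp_all flip: power_add)
      have "?T (m + j) = (- 1) ^ (m + j) * (r ^ (m + j) * r ^ (K - (m + j))) * (c ^ (N - j) * c ^ j)
          * (of_nat (k choose (m + j)) * of_nat (l choose (K - (m + j))) / of_nat (K choose (m + j)))"
      proof -
        have "coeff (chart_poly True c r K k) (m + j) = of_nat (k choose (m + j)) * r ^ (m + j) * c ^ (N - j)"
          using cT[of "m + j"] N(1) by simp
        moreover have "coeff (chart_poly False c r K l) (m + j)
            = of_nat (l choose (K - (m + j))) * r ^ (K - (m + j)) * c ^ j"
          using cF[of "m + j"] j N(3) by (simp flip: m_def)
        ultimately show ?thesis
          by (simp add: mult_ac)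
      qed
      also have "of_nat (k choose (m + j)) * of_nat (l choose (K - (m + j))) / of_nat (K choose (m + j))
          = fact k * fact l / (fact K * fact N) * (of_nat (N choose j) :: complex)"
        unfolding 1 2 3 4 by (simp add: field_simps)
      finally show "?T (m + j) = ((- 1) ^ m * r ^ K * c ^ N * fact k * fact l / (fact K * fact N)) *
        ((- 1) ^ j * of_nat (N choose j))"
        unfolding p by (simp add: power_add mult_ac)
    qed
    also have "\<dots> = ((- 1) ^ m * r ^ K * c ^ N * fact k * fact l / (fact K * fact N)) *
        (\<Sum>j\<le>N. (- 1) ^ j * of_nat (N choose j))"
      by (rule sum_distrib_left[symmetric])
    also have "\<dots> = (if k + l = K then (- 1) ^ k * r ^ K * fact k * fact l / fact K else 0)"
    proof (cases "N = 0")
      case True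
      then show ?thesis using N by simp
    next
      case False
      then show ?thesis
        using N choose_alternating_sum[of N, where ?'a = complex] by simp
    qed
    finally show ?thesis .
  qed
qed

lemma basis_eval_chart:
  assumes "finite I" and z: "\<And>i. i \<in> I \<Longrightarrow> fin i \<or> z i \<noteq> 0"
  shows "basis_eval I \<kappa> (\<lambda>i. chart_poly (fin i) (c i) (r i) (\<kappa> i)) f z =
    (\<Prod>i\<in>I. if fin i then 1 else z i ^ \<kappa> i) *
    (\<Sum>\<alpha>\<in>exps I \<kappa>. f \<alpha> * (\<Prod>i\<in>I. chart_point (fin i) (c i) (r i) (z i) ^ \<alpha> i))"
proof -
  have "(\<Prod>i\<in>I. poly (chart_poly (fin i) (c i) (r i) (\<kappa> i) (\<alpha> i)) (z i)) =
      (\<Prod>i\<in>I. if fin i then 1 else z i ^ \<kappa> i) * (\<Prod>i\<in>I. chart_point (fin i) (c i) (r i) (z i) ^ \<alpha> i)"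
    if "\<alpha> \<in> exps I \<kappa>" for \<alpha>
    using that z unfolding prod.distrib[symmetric]
    by (intro prod.cong refl poly_chart_poly) (auto simp: PiE_iff)
  then show ?thesis
    unfolding basis_eval_def sum_distrib_left by (intro sum.cong) (auto simp: mult_ac)
qed

lemma inj_chart_point: "r \<noteq> 0 \<Longrightarrow> inj_on (chart_point fin c r) (- {0})"
  by (auto simp: inj_on_def chart_point_def field_simps)

text \<open>
  At \<open>w\<^sub>i = 0\<close> only the terms of full degree \<open>\<kappa>\<^sub>i\<close> survive. They form a nonzero polynomial, which
  cannot vanish throughout a product of infinite sets; those sets are the images of punctured discs.
\<close>

lemma leading_part_nonvanishing_somewhere:
  assumes I: "finite I" and r: "\<And>i. r i \<noteq> 0" and i: "i \<in> I" "\<not> fin i"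
    and \<alpha>: "\<alpha> \<in> exps I \<kappa>" "\<alpha> i = \<kappa> i" "f \<alpha> \<noteq> 0"
  shows "\<exists>z. z i = 0 \<and> (\<forall>j\<in>I. norm (z j) < 1) \<and>
    basis_eval I \<kappa> (\<lambda>i. chart_poly (fin i) (c i) (r i) (\<kappa> i)) f z \<noteq> 0"
proof -
  define e where "e \<alpha> = (if \<alpha> i = \<kappa> i then f \<alpha> else 0)" for \<alpha>
  define S where "S j = chart_point (fin j) (c j) (r j) ` (ball 0 1 - {0})" for j
  have "infinite (S j)" for j
  proof -
    have "infinite (ball (0::complex) 1 - {0})"
      using uncountable_ball[of 1 "0::complex"] by (auto dest: countable_finite)
    moreover have "inj_on (chart_point (fin j) (c j) (r j)) (ball 0 1 - {0})"
      by (rule inj_on_subset[OF inj_chart_point[OF r]]) auto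
    ultimately show ?thesis
      unfolding S_def by (simp add: finite_image_iff)
  qed
  then obtain x where x: "\<forall>j\<in>I. x j \<in> S j" "(\<Sum>\<alpha>\<in>exps I \<kappa>. e \<alpha> * (\<Prod>j\<in>I. x j ^ \<alpha> j)) \<noteq> 0"
    using nonzero_on_infinite_grid[OF I, of S \<alpha> \<kappa> e] \<alpha> by (auto simp: e_def)
  from x(1) have "\<forall>j\<in>I. \<exists>w. norm w < 1 \<and> w \<noteq> 0 \<and> x j = chart_point (fin j) (c j) (r j) w"
    unfolding S_def by fastforce
  then obtain w where w: "\<And>j. j \<in> I \<Longrightarrow> norm (w j) < 1" "\<And>j. j \<in> I \<Longrightarrow> w j \<noteq> 0"
      "\<And>j. j \<in> I \<Longrightarrow> x j = chart_point (fin j) (c j) (r j) (w j)"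
    by metis
  define z where "z = w(i := 0)"
  define s where "s = (\<Prod>j\<in>I - {i}. if fin j then 1 else w j ^ \<kappa> j)"
  have "x i ^ \<kappa> i * (f \<beta> * (\<Prod>j\<in>I. poly (chart_poly (fin j) (c j) (r j) (\<kappa> j) (\<beta> j)) (z j)))
      = s * r i ^ \<kappa> i * (e \<beta> * (\<Prod>j\<in>I. x j ^ \<beta> j))" if \<beta>: "\<beta> \<in> exps I \<kappa>" for \<beta>
  proof -
    have "(\<Prod>j\<in>I - {i}. poly (chart_poly (fin j) (c j) (r j) (\<kappa> j) (\<beta> j)) (z j))
        = s * (\<Prod>j\<in>I - {i}. x j ^ \<beta> j)"
      unfolding s_def prod.distrib[symmetric]
    proof (intro prod.cong refl)
      fix j assume j: "j \<in> I - {i}"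
      then have "\<beta> j \<le> \<kappa> j"
        using \<beta> by (auto simp: PiE_iff)
      then show "poly (chart_poly (fin j) (c j) (r j) (\<kappa> j) (\<beta> j)) (z j)
          = (if fin j then 1 else w j ^ \<kappa> j) * x j ^ \<beta> j"
        using j w by (auto simp: z_def poly_chart_poly)
    qed
    moreover have "poly (chart_poly (fin i) (c i) (r i) (\<kappa> i) (\<beta> i)) (z i) = (if \<beta> i = \<kappa> i then r i ^ \<kappa> i else 0)"
      using \<beta> i by (simp add: z_def poly_chart_poly_0 PiE_iff)
    ultimately show ?thesis
      using I i by (simp add: prod.remove[where x = i] e_def)
  qed
  then have "x i ^ \<kappa> i * basis_eval I \<kappa> (\<lambda>i. chart_poly (fin i) (c i) (r i) (\<kappa> i)) f z
      = s * r i ^ \<kappa> i * (\<Sum>\<alpha>\<in>exps I \<kappa>. e \<alpha> * (\<Prod>j\<in>I. x j ^ \<alpha> j))"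
    unfolding basis_eval_def sum_distrib_left by (intro sum.cong) auto
  moreover have "s * r i ^ \<kappa> i \<noteq> 0"
    using w(2) I r by (auto simp: s_def)
  ultimately have "basis_eval I \<kappa> (\<lambda>i. chart_poly (fin i) (c i) (r i) (\<kappa> i)) f z \<noteq> 0"
    using x(2) by auto
  moreover have "z i = 0 \<and> (\<forall>j\<in>I. norm (z j) < 1)"
    using w by (simp add: z_def)
  ultimately show ?thesis by blast
qed

text \<open>
  Stability and the degree condition give nonvanishing at infinity as well. Nonvanishing is
  known where all coordinates of infinite charts are nonzero, and zero coordinates are removed
  one at a time. Suppose \<open>z\<^sub>i = 0\<close>. By the degree condition the restriction to \<open>w\<^sub>i = 0\<close> is not
  identically zero, so along a generic line through \<open>z\<close> in that hyperplane it is nonzero near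
  \<open>z\<close>, except perhaps at \<open>z\<close>. At these nearby points the slice in direction \<open>i\<close> has no zero in
  the unit disc, hence is bounded by a constant times its value at \<open>0\<close>. In the limit a zero at \<open>z\<close>
  would force the slice through \<open>z\<close> to vanish throughout, contrary to what is known off the
  hyperplane.
\<close>

theorem chart_nonvanishing:
  fixes S :: "complex set" and f :: "('i \<Rightarrow> nat) \<Rightarrow> complex"
  assumes I: "finite I" and S: "convex S" "ball 0 1 \<subseteq> S" and r: "\<And>i. r i \<noteq> 0"
    and nz: "\<And>w. \<forall>i\<in>I. w i \<in> S \<and> (fin i \<or> w i \<noteq> 0) \<Longrightarrow>
      (\<Sum>\<alpha>\<in>exps I \<kappa>. f \<alpha> * (\<Prod>i\<in>I. chart_point (fin i) (c i) (r i) (w i) ^ \<alpha> i)) \<noteq> 0"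
    and lead: "\<And>i. i \<in> I \<Longrightarrow> \<not> fin i \<Longrightarrow> \<exists>\<alpha>\<in>exps I \<kappa>. \<alpha> i = \<kappa> i \<and> f \<alpha> \<noteq> 0"
    and z: "\<forall>i\<in>I. z i \<in> S"
  shows "basis_eval I \<kappa> (\<lambda>i. chart_poly (fin i) (c i) (r i) (\<kappa> i)) f z \<noteq> 0"
  using z
proof (induction "card {i\<in>I. \<not> fin i \<and> z i = 0}" arbitrary: z rule: less_induct)
  case less
  define G where "G = basis_eval I \<kappa> (\<lambda>i. chart_poly (fin i) (c i) (r i) (\<kappa> i)) f"
  show ?case
  proof (cases "\<exists>i\<in>I. \<not> fin i \<and> z i = 0")
    case False
    then show ?thesis
      using I nz[of z] less.prems by (subst basis_eval_chart) auto
  next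
    case True
    then obtain i where i: "i \<in> I" "\<not> fin i" "z i = 0"
      by blast
    have near: "G w \<noteq> 0"
      if w: "\<forall>j\<in>I. w j \<in> S" "w i \<noteq> 0" "\<forall>j\<in>I. z j \<noteq> 0 \<longrightarrow> w j \<noteq> 0" for w
    proof -
      have "{j\<in>I. \<not> fin j \<and> w j = 0} \<subset> {j\<in>I. \<not> fin j \<and> z j = 0}"
        using w i by blast
      then show ?thesis
        unfolding G_def using less.hyps[OF psubset_card_mono] I w by auto
    qed
    obtain z1 where z1: "z1 i = 0" "\<forall>j\<in>I. norm (z1 j) < 1" "G z1 \<noteq> 0"
      using leading_part_nonvanishing_somewhere
        [where fin = fin and c = c and r = r and i = i and f = f and \<kappa> = \<kappa>, OF I r i(1,2)]
        lead[OF i(1,2)]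
      unfolding G_def by blast
    define P where "P i = chart_poly (fin i) (c i) (r i) (\<kappa> i)" for i
    have G: "G = basis_eval I \<kappa> P f"
      by (simp add: G_def P_def[abs_def])
    define R where "R j = [:z j, z1 j - z j:]" for j
    define Z where "Z t j = poly (R j) (complex_of_real t)" for t j
    \<comment> \<open>The second factor keeps the nonzero coordinates of \<open>z\<close> nonzero along the line, so that
      \<open>near\<close> applies.\<close>
    define Q where "Q = subst_poly I \<kappa> P f R * (\<Prod>j\<in>{j\<in>I. z j \<noteq> 0}. R j)"
    have "poly (subst_poly I \<kappa> P f R) 1 = G z1"
      unfolding G poly_subst_poly by (rule basis_eval_cong) (simp add: R_def)
    then have "Q \<noteq> 0"
      using z1(3) I by (auto simp: Q_def R_def)
    then have "finite {t. poly Q (complex_of_real t) = 0}"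
      using finite_vimageI[OF poly_roots_finite[of Q], of complex_of_real]
      by (simp add: vimage_def inj_of_real)
    then have "eventually (\<lambda>t. poly Q (complex_of_real t) \<noteq> 0) (at_right 0)"
      using islimpt_finite[of "{t. poly Q (complex_of_real t) = 0}" 0]
      by (auto simp: islimpt_iff_eventually eventually_at_filter elim: eventually_mono)
    moreover have "eventually (\<lambda>t. t \<in> {0<..<1::real}) (at_right 0)"
      by (rule eventually_at_right_real) simp
    ultimately have ev: "eventually (\<lambda>t. norm (G ((Z t)(i := 1 / 2))) \<le> 2 ^ \<kappa> i * norm (G (Z t))) (at_right 0)"
    proof eventually_elim
      case (elim t)
      have "Z t j \<in> S" if "j \<in> I" for j
      proof -
        have "(1 - t) *\<^sub>R z j + t *\<^sub>R z1 j \<in> S"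
          using elim(2) less.prems z1(2) S that by (intro convexD[OF S(1)]) auto
        moreover have "(1 - t) *\<^sub>R z j + t *\<^sub>R z1 j = Z t j"
          by (simp add: Z_def R_def scaleR_conv_of_real algebra_simps)
        ultimately show ?thesis by simp
      qed
      moreover have "Z t j \<noteq> 0" if "j \<in> I" "z j \<noteq> 0" for j
        using elim(1) that I by (auto simp: Q_def Z_def poly_prod)
      moreover have "G (Z t) \<noteq> 0"
        using elim(1) by (auto simp: Q_def poly_subst_poly G Z_def[abs_def])
      moreover have Zi: "Z t i = 0"
        using i z1 by (simp add: Z_def R_def)
      ultimately have nz_slice: "G ((Z t)(i := x)) \<noteq> 0" if "norm x < 1" for x
        using near[of "(Z t)(i := x)"] that S(2) i by (cases "x = 0") (auto simp: fun_upd_idem subset_iff)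
      define p where "p = subst_poly I \<kappa> P f (\<lambda>j. if j = i then [:0, 1:] else [:Z t j:])"
      have p: "poly p x = G ((Z t)(i := x))" for x
        unfolding p_def poly_subst_poly G by (rule basis_eval_cong) simp
      have "norm (poly p (1 / 2)) \<le> 2 ^ \<kappa> i * norm (poly p 0)"
      proof (rule norm_poly_le_at_0)
        show "degree p \<le> \<kappa> i"
          unfolding p_def using I i(1) by (rule degree_slice_le) (simp add: P_def degree_chart_poly_le)
      qed (use nz_slice p in auto)
      then show ?case
        unfolding p using Zi by (simp add: fun_upd_idem)
    qed
    have lim: "((\<lambda>t. G (W t)) \<longlongrightarrow> G w) (at_right 0)"
      if "\<And>j. ((\<lambda>t. W t j) \<longlongrightarrow> w j) (at_right (0::real))" for W w
      unfolding G using that by (rule tendsto_basis_eval)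
    have limZ: "((\<lambda>t. Z t j) \<longlongrightarrow> z j) (at_right 0)" for j
    proof -
      have "((\<lambda>t. Z t j) \<longlongrightarrow> Z 0 j) (at_right 0)"
        unfolding Z_def by (intro tendsto_intros)
      then show ?thesis by (simp add: Z_def R_def)
    qed
    have "norm (G (z(i := 1 / 2))) \<le> 2 ^ \<kappa> i * norm (G z)"
      by (rule tendsto_le[OF trivial_limit_at_right_real _ _ ev])
         (intro tendsto_intros lim; use limZ in \<open>simp add: fun_upd_def\<close>)+
    moreover have "G (z(i := 1 / 2)) \<noteq> 0"
      using less.prems S(2) by (intro near) (auto simp: subset_iff)
    ultimately have "G z \<noteq> 0"
      by auto
    then show ?thesis
      by (simp add: G_def)
  qed
qed

section \<open>The bracket of coefficient arrays\<close>

text \<open>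
  In charts that turn each region (for \<open>f\<close>) or its complement (for \<open>g\<close>) into a unit disc, \<open>f\<close> has no zero on the open unit polydisc and \<open>g\<close> none on the
  closed one, hence none on a slightly larger one. So the pairing of the two is nonzero, and since
  the pairing of two chart monomials is zero unless the exponents add up to \<open>\<kappa>\<close>, it is a nonzero
  multiple of the bracket.
\<close>

lemma bracket_form_nonzero:
  fixes f g :: "('i \<Rightarrow> nat) \<Rightarrow> complex" and c r :: "'i \<Rightarrow> complex"
  assumes I: "finite I" and r: "\<And>i. r i \<noteq> 0"
    and f: "\<And>w. \<forall>i\<in>I. norm (w i) < 1 \<and> (fin i \<or> w i \<noteq> 0) \<Longrightarrow>
      (\<Sum>\<alpha>\<in>exps I \<kappa>. f \<alpha> * (\<Prod>i\<in>I. chart_point (fin i) (c i) (r i) (w i) ^ \<alpha> i)) \<noteq> 0"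
    and g: "\<And>w. \<forall>i\<in>I. norm (w i) \<le> 1 \<and> (\<not> fin i \<or> w i \<noteq> 0) \<Longrightarrow>
      (\<Sum>\<alpha>\<in>exps I \<kappa>. g \<alpha> * (\<Prod>i\<in>I. chart_point (\<not> fin i) (c i) (r i) (w i) ^ \<alpha> i)) \<noteq> 0"
    and lead_f: "\<And>i. i \<in> I \<Longrightarrow> \<not> fin i \<Longrightarrow> \<exists>\<alpha>\<in>exps I \<kappa>. \<alpha> i = \<kappa> i \<and> f \<alpha> \<noteq> 0"
    and lead_g: "\<And>i. i \<in> I \<Longrightarrow> fin i \<Longrightarrow> \<exists>\<alpha>\<in>exps I \<kappa>. \<alpha> i = \<kappa> i \<and> g \<alpha> \<noteq> 0"
  shows "(\<Sum>\<alpha>\<in>exps I \<kappa>. f \<alpha> * g (\<lambda>i\<in>I. \<kappa> i - \<alpha> i) *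
    (\<Prod>i\<in>I. (- 1) ^ \<alpha> i * fact (\<alpha> i) * fact (\<kappa> i - \<alpha> i))) \<noteq> 0"
proof -
  define P where "P i = chart_poly (fin i) (c i) (r i) (\<kappa> i)" for i
  define Q where "Q i = chart_poly (\<not> fin i) (c i) (r i) (\<kappa> i)" for i
  have F: "basis_eval I \<kappa> P f z \<noteq> 0" if "\<forall>i\<in>I. norm (z i) < 1" for z
    unfolding P_def[abs_def]
    using that f lead_f by (intro chart_nonvanishing[where S = "ball 0 1"] I r) auto
  have "basis_eval I \<kappa> Q g u \<noteq> 0" if "\<forall>i\<in>I. norm (u i) \<le> 1" for u
    unfolding Q_def[abs_def]
    using that g lead_g by (intro chart_nonvanishing[where S = "cball 0 1"] I r) auto
  then obtain \<rho> where \<rho>: "\<rho> > 1"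
      and G: "\<And>u. \<forall>i\<in>I. norm (u i) < \<rho> \<Longrightarrow> basis_eval I \<kappa> Q g u \<noteq> 0"
    using nonvanishing_polydisc_fatten[OF I, of \<kappa> Q g] by blast
  have "(\<Sum>\<alpha>\<in>exps I \<kappa>. \<Sum>\<beta>\<in>exps I \<kappa>. f \<alpha> * g \<beta> *
      (\<Prod>i\<in>I. pairing (\<kappa> i) (P i (\<alpha> i)) (Q i (\<beta> i)))) \<noteq> 0"
  proof (rule multivariate_pairing_nonzero[OF I \<rho>])
    fix z u :: "'i \<Rightarrow> complex"
    assume z: "\<forall>i\<in>I. norm (z i) < 1" and u: "\<forall>i\<in>I. norm (u i) < \<rho>"
    have "(\<Sum>\<alpha>\<in>exps I \<kappa>. \<Sum>\<beta>\<in>exps I \<kappa>. f \<alpha> * g \<beta> *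
        (\<Prod>i\<in>I. poly (P i (\<alpha> i)) (z i) * poly (Q i (\<beta> i)) (u i)))
      = basis_eval I \<kappa> P f z * basis_eval I \<kappa> Q g u"
      unfolding basis_eval_def sum_product by (simp add: prod.distrib mult_ac)
    then show "(\<Sum>\<alpha>\<in>exps I \<kappa>. \<Sum>\<beta>\<in>exps I \<kappa>. f \<alpha> * g \<beta> *
        (\<Prod>i\<in>I. poly (P i (\<alpha> i)) (z i) * poly (Q i (\<beta> i)) (u i))) \<noteq> 0"
      using F[OF z] G[OF u] by simp
  qed (simp_all add: P_def Q_def degree_chart_poly_le)
  also have "(\<Sum>\<alpha>\<in>exps I \<kappa>. \<Sum>\<beta>\<in>exps I \<kappa>. f \<alpha> * g \<beta> *
      (\<Prod>i\<in>I. pairing (\<kappa> i) (P i (\<alpha> i)) (Q i (\<beta> i))))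
    = (\<Prod>i\<in>I. (if fin i then 1 else (- 1) ^ \<kappa> i) * r i ^ \<kappa> i / fact (\<kappa> i)) *
      (\<Sum>\<alpha>\<in>exps I \<kappa>. f \<alpha> * g (\<lambda>i\<in>I. \<kappa> i - \<alpha> i) *
        (\<Prod>i\<in>I. (- 1) ^ \<alpha> i * fact (\<alpha> i) * fact (\<kappa> i - \<alpha> i)))"
    unfolding sum_distrib_left
  proof (intro sum.cong refl)
    fix \<alpha> assume \<alpha>: "\<alpha> \<in> exps I \<kappa>"
    define \<beta>0 where "\<beta>0 = (\<lambda>i\<in>I. \<kappa> i - \<alpha> i)"
    have \<beta>0: "\<beta>0 \<in> exps I \<kappa>"
      by (auto simp: \<beta>0_def)
    have pair: "pairing (\<kappa> i) (P i a) (Q i b) = (if a + b = \<kappa> i then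
        (if fin i then 1 else (- 1) ^ \<kappa> i) * r i ^ \<kappa> i / fact (\<kappa> i) * ((- 1) ^ a * fact a * fact (\<kappa> i - a)) else 0)"
      if "a \<le> \<kappa> i" "b \<le> \<kappa> i" for i a b
    proof (cases "a + b = \<kappa> i")
      case True
      then have b: "\<kappa> i - a = b"
        by simp
      have "(- 1) ^ b = (- 1) ^ (a + b) * ((- 1) ^ a :: complex)"
        by (simp add: power_add flip: power_mult_distrib)
      then have "(- 1) ^ b = (- 1) ^ \<kappa> i * ((- 1) ^ a :: complex)"
        unfolding True .
      then show ?thesis
        using that True b
        by (cases "fin i") (simp_all add: P_def Q_def pairing_charts pairing_commute[of _ "chart_poly False _ _ _ _"]
            add.commute mult_ac)
    next
      case False
      then show ?thesis
        using that
        by (cases "fin i") (simp_all add: P_def Q_def pairing_charts pairing_commute[of _ "chart_poly False _ _ _ _"]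
            add.commute)
    qed
    have "(\<Prod>i\<in>I. pairing (\<kappa> i) (P i (\<alpha> i)) (Q i (\<beta> i))) = 0"
      if \<beta>: "\<beta> \<in> exps I \<kappa>" "\<beta> \<noteq> \<beta>0" for \<beta>
    proof -
      obtain i where i: "i \<in> I" "\<beta> i \<noteq> \<beta>0 i"
        using PiE_ext[OF \<beta>(1) \<beta>0] \<beta>(2) by blast
      have "\<alpha> i \<le> \<kappa> i" "\<beta> i \<le> \<kappa> i"
        using \<alpha> \<beta> i by (auto simp: PiE_iff)
      then have "pairing (\<kappa> i) (P i (\<alpha> i)) (Q i (\<beta> i)) = 0"
        using i by (subst pair) (auto simp: \<beta>0_def)
      then show ?thesis
        using I i by (auto intro!: prod_zero)
    qed
    then have "(\<Sum>\<beta>\<in>exps I \<kappa>. f \<alpha> * g \<beta> * (\<Prod>i\<in>I. pairing (\<kappa> i) (P i (\<alpha> i)) (Q i (\<beta> i))))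
        = (\<Sum>\<beta>\<in>{\<beta>0}. f \<alpha> * g \<beta> * (\<Prod>i\<in>I. pairing (\<kappa> i) (P i (\<alpha> i)) (Q i (\<beta> i))))"
      using \<beta>0 I by (intro sum.mono_neutral_right) (auto simp: finite_exps)
    also have "\<dots> = f \<alpha> * g \<beta>0 * (\<Prod>i\<in>I. pairing (\<kappa> i) (P i (\<alpha> i)) (Q i (\<beta>0 i)))"
      by simp
    also have "(\<Prod>i\<in>I. pairing (\<kappa> i) (P i (\<alpha> i)) (Q i (\<beta>0 i)))
        = (\<Prod>i\<in>I. ((if fin i then 1 else (- 1) ^ \<kappa> i) * r i ^ \<kappa> i / fact (\<kappa> i)) *
          ((- 1) ^ \<alpha> i * fact (\<alpha> i) * fact (\<kappa> i - \<alpha> i)))"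
      using \<alpha> by (intro prod.cong refl, subst pair) (auto simp: \<beta>0_def PiE_iff)
    also have "\<dots> = (\<Prod>i\<in>I. (if fin i then 1 else (- 1) ^ \<kappa> i) * r i ^ \<kappa> i / fact (\<kappa> i)) *
        (\<Prod>i\<in>I. (- 1) ^ \<alpha> i * fact (\<alpha> i) * fact (\<kappa> i - \<alpha> i))"
      by (rule prod.distrib)
    finally show "(\<Sum>\<beta>\<in>exps I \<kappa>. f \<alpha> * g \<beta> * (\<Prod>i\<in>I. pairing (\<kappa> i) (P i (\<alpha> i)) (Q i (\<beta> i))))
      = (\<Prod>i\<in>I. (if fin i then 1 else (- 1) ^ \<kappa> i) * r i ^ \<kappa> i / fact (\<kappa> i)) *
        (f \<alpha> * g (\<lambda>i\<in>I. \<kappa> i - \<alpha> i) * (\<Prod>i\<in>I. (- 1) ^ \<alpha> i * fact (\<alpha> i) * fact (\<kappa> i - \<alpha> i)))"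
      unfolding \<beta>0_def by (simp only: mult_ac)
  qed
  finally show ?thesis
    by auto
qed

section \<open>Coefficients and derivatives of polynomial mappings\<close>

definition monomial_of :: "nat set \<Rightarrow> (nat \<Rightarrow> nat) \<Rightarrow> (nat \<Rightarrow>\<^sub>0 nat)" where
  "monomial_of A \<alpha> = (\<Sum>i\<in>A. Poly_Mapping.single i (\<alpha> i))"

lemma lookup_monomial_of:
  "finite A \<Longrightarrow> Poly_Mapping.lookup (monomial_of A \<alpha>) i = (if i \<in> A then \<alpha> i else 0)"
  by (simp add: monomial_of_def lookup_sum lookup_single when_def)

lemma monomial_of_lookup:
  assumes "finite A" "Poly_Mapping.keys m \<subseteq> A"
  shows "monomial_of A (restrict (Poly_Mapping.lookup m) A) = m"
  by (rule poly_mapping_eqI) (use assms in \<open>auto simp: lookup_monomial_of in_keys_iff\<close>)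

lemma lookup_le_deg_in: "m \<in> Poly_Mapping.keys f \<Longrightarrow> Poly_Mapping.lookup m i \<le> deg_in i f"
  unfolding deg_in_def by (rule Max_ge) auto

lemma polys_keys_exps:
  assumes "f \<in> polys n \<kappa>" "m \<in> Poly_Mapping.keys f"
  shows "restrict (Poly_Mapping.lookup m) {1..n} \<in> exps {1..n} \<kappa>"
    "monomial_of {1..n} (restrict (Poly_Mapping.lookup m) {1..n}) = m"
proof -
  show "restrict (Poly_Mapping.lookup m) {1..n} \<in> exps {1..n} \<kappa>"
  proof (subst restrict_PiE_iff, intro ballI)
    fix i assume "i \<in> {1..n}"
    then have "deg_in i f \<le> \<kappa> i"
      using assms(1) by (simp add: polys_def)
    then show "Poly_Mapping.lookup m i \<in> {..\<kappa> i}"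
      using lookup_le_deg_in[OF assms(2), of i] by simp
  qed
  show "monomial_of {1..n} (restrict (Poly_Mapping.lookup m) {1..n}) = m"
    using assms by (intro monomial_of_lookup) (auto simp: polys_def)
qed

lemma inj_on_monomial_of:
  assumes "finite A"
  shows "inj_on (monomial_of A) (exps A \<kappa>)"
proof (rule inj_onI, erule (1) PiE_ext)
  fix \<alpha> \<beta> i
  assume "monomial_of A \<alpha> = monomial_of A \<beta>" "i \<in> A"
  then show "\<alpha> i = \<beta> i"
    using lookup_monomial_of[OF assms, of \<alpha> i] lookup_monomial_of[OF assms, of \<beta> i] by simp
qed

lemma peval_polys:
  assumes f: "f \<in> polys n \<kappa>"
  shows "peval f z = (\<Sum>\<alpha>\<in>exps {1..n} \<kappa>.
    Poly_Mapping.lookup f (monomial_of {1..n} \<alpha>) * (\<Prod>i\<in>{1..n}. z i ^ \<alpha> i))"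
proof -
  have "Poly_Mapping.keys f \<subseteq> monomial_of {1..n} ` exps {1..n} \<kappa>"
    using polys_keys_exps[OF f] by (metis image_eqI subsetI)
  then have "peval f z = (\<Sum>m\<in>monomial_of {1..n} ` exps {1..n} \<kappa>.
      Poly_Mapping.lookup f m * (\<Prod>i\<in>Poly_Mapping.keys m. z i ^ Poly_Mapping.lookup m i))"
    by (intro peval_superset finite_imageI finite_exps) auto
  also have "\<dots> = (\<Sum>\<alpha>\<in>exps {1..n} \<kappa>. Poly_Mapping.lookup f (monomial_of {1..n} \<alpha>) *
      (\<Prod>i\<in>Poly_Mapping.keys (monomial_of {1..n} \<alpha>). z i ^ Poly_Mapping.lookup (monomial_of {1..n} \<alpha>) i))"
    by (subst sum.reindex) (simp_all add: inj_on_monomial_of)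
  also have "\<dots> = (\<Sum>\<alpha>\<in>exps {1..n} \<kappa>.
    Poly_Mapping.lookup f (monomial_of {1..n} \<alpha>) * (\<Prod>i\<in>{1..n}. z i ^ \<alpha> i))"
  proof (intro sum.cong refl arg_cong2[where f = "(*)"])
    fix \<alpha>
    have "Poly_Mapping.keys (monomial_of {1..n} \<alpha>) \<subseteq> {1..n}"
      by (auto simp: in_keys_iff lookup_monomial_of split: if_splits)
    then show "(\<Prod>i\<in>Poly_Mapping.keys (monomial_of {1..n} \<alpha>). z i ^ Poly_Mapping.lookup (monomial_of {1..n} \<alpha>) i)
        = (\<Prod>i\<in>{1..n}. z i ^ \<alpha> i)"
      by (subst monomial_superset) (auto simp: lookup_monomial_of)
  qed
  finally show ?thesis .
qed

lemma lookup_partial: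
  "Poly_Mapping.lookup (partial i f) m
    = of_nat (Suc (Poly_Mapping.lookup m i)) * Poly_Mapping.lookup f (m + Poly_Mapping.single i 1)"
proof -
  let ?e = "Poly_Mapping.single i (1 :: nat)"
  have *: "(of_nat (Poly_Mapping.lookup k i) * Poly_Mapping.lookup f k when k - ?e = m)
      = (of_nat (Suc (Poly_Mapping.lookup m i)) * Poly_Mapping.lookup f (m + ?e) when k = m + ?e)" for k
  proof (cases "Poly_Mapping.lookup k i = 0")
    case True
    then have "k \<noteq> m + ?e"
      by (auto simp: lookup_add)
    then show ?thesis using True by (simp add: when_def)
  next
    case False
    have "k - ?e + ?e = k"
      by (rule poly_mapping_eqI) (use False in \<open>auto simp: lookup_add lookup_minus lookup_single when_def\<close>)
    then have "k - ?e = m \<longleftrightarrow> k = m + ?e"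
      by auto
    then show ?thesis
      by (auto simp: when_def lookup_add)
  qed
  have "Poly_Mapping.lookup (partial i f) m = (\<Sum>k\<in>Poly_Mapping.keys f.
      (of_nat (Poly_Mapping.lookup k i) * Poly_Mapping.lookup f k when k - ?e = m))"
    unfolding partial_def lookup_sum lookup_single ..
  also have "\<dots> = of_nat (Suc (Poly_Mapping.lookup m i)) * Poly_Mapping.lookup f (m + ?e)"
    unfolding * by (auto simp: when_def in_keys_iff)
  finally show ?thesis .
qed

text \<open>
  The induction on \<open>k\<close> shifts the exponent of variable \<open>i\<close>; this exponent is therefore split off
  as a separate \<open>j\<close>.
\<close>

lemma lookup_partial_pow:
  "Poly_Mapping.lookup m i = 0 \<Longrightarrow> Poly_Mapping.lookup ((partial i ^^ k) f) (m + Poly_Mapping.single i j)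
    = fact (j + k) / fact j * Poly_Mapping.lookup f (m + Poly_Mapping.single i (j + k))"
proof (induction k arbitrary: j)
  case 0
  then show ?case by simp
next
  case (Suc k)
  have "m + Poly_Mapping.single i j + Poly_Mapping.single i 1 = m + Poly_Mapping.single i (Suc j)"
    by (simp add: add.assoc single_add[symmetric])
  then show ?case
    using Suc.IH[of "Suc j"] Suc.prems
    by (simp add: lookup_partial lookup_add field_simps del: of_nat_Suc)
qed

lemma lookup_fold_partial:
  assumes "distinct is" "\<And>i. i \<in> set is \<Longrightarrow> Poly_Mapping.lookup m i = 0"
  shows "Poly_Mapping.lookup (fold (\<lambda>i. partial i ^^ \<alpha> i) is f) m
    = (\<Prod>i\<in>set is. fact (\<alpha> i)) * Poly_Mapping.lookup f (m + monomial_of (set is) \<alpha>)"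
  using assms
proof (induction "is" arbitrary: f)
  case Nil
  then show ?case by (simp add: monomial_of_def)
next
  case (Cons i js)
  have 0: "Poly_Mapping.lookup (m + monomial_of (set js) \<alpha>) i = 0"
    using Cons.prems by (simp add: lookup_add lookup_monomial_of)
  show ?case
    using Cons lookup_partial_pow[OF 0, of "\<alpha> i" f 0]
    by (simp add: monomial_of_def add_ac mult_ac)
qed

lemma peval_0: "peval f (\<lambda>_. 0) = Poly_Mapping.lookup f 0"
proof -
  have *: "(\<Prod>i\<in>Poly_Mapping.keys m. (0::complex) ^ Poly_Mapping.lookup m i) = (if m = 0 then 1 else 0)" for m
  proof (cases "m = 0")
    case False
    then obtain i where "i \<in> Poly_Mapping.keys m"
      by (metis all_not_in_conv keys_eq_empty)
    then show ?thesis
      using False by (auto simp: in_keys_iff intro!: prod_zero bexI[of _ i])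
  qed simp
  have "peval f (\<lambda>_. 0) = (\<Sum>m\<in>Poly_Mapping.keys f. if m = 0 then Poly_Mapping.lookup f m else 0)"
    unfolding peval_def * by (intro sum.cong refl) simp
  then show ?thesis
    by (simp add: in_keys_iff)
qed

lemma peval_partials_0:
  "peval (partials n \<alpha> f) (\<lambda>_. 0)
    = (\<Prod>i\<in>{1..n}. fact (\<alpha> i)) * Poly_Mapping.lookup f (monomial_of {1..n} \<alpha>)"
proof -
  have "set [1..<Suc n] = {1..n}"
    by auto
  then show ?thesis
    using lookup_fold_partial[of "[1..<Suc n]" 0 \<alpha> f] by (simp add: peval_0 partials_def del: upt_Suc)
qed

lemma bracket_eq_sum:
  "bracket n \<kappa> f g = (\<Sum>\<alpha>\<in>exps {1..n} \<kappa>. Poly_Mapping.lookup f (monomial_of {1..n} \<alpha>) *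
    Poly_Mapping.lookup g (monomial_of {1..n} (\<lambda>i\<in>{1..n}. \<kappa> i - \<alpha> i)) *
    (\<Prod>i\<in>{1..n}. (- 1) ^ \<alpha> i * fact (\<alpha> i) * fact (\<kappa> i - \<alpha> i)))"
proof -
  have "monomial_of {1..n} (\<lambda>i\<in>{1..n}. \<kappa> i - \<alpha> i) = monomial_of {1..n} (\<lambda>i. \<kappa> i - \<alpha> i)" for \<alpha>
    by (simp add: monomial_of_def)
  then show ?thesis
    unfolding bracket_def peval_partials_0 by (simp add: prod.distrib power_sum mult_ac)
qed

text \<open>
  Nonvanishing at a point rules out the zero polynomial, whose conventional degree \<open>0\<close> would
  satisfy the degree condition when \<open>\<kappa> j = 0\<close>.
\<close>

lemma leading_exponent_exists:
  assumes f: "f \<in> polys n \<kappa>" and "deg_in j f = \<kappa> j" "j \<in> {1..n}"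
    and z: "peval f z \<noteq> 0"
  shows "\<exists>\<alpha>\<in>exps {1..n} \<kappa>. \<alpha> j = \<kappa> j \<and> Poly_Mapping.lookup f (monomial_of {1..n} \<alpha>) \<noteq> 0"
proof -
  have "\<exists>m\<in>Poly_Mapping.keys f. Poly_Mapping.lookup m j = \<kappa> j"
  proof (cases "\<kappa> j = 0")
    case True
    have "f \<noteq> 0"
      using z by auto
    then obtain m where "m \<in> Poly_Mapping.keys f"
      by (metis all_not_in_conv keys_eq_empty)
    then show ?thesis
      using True assms(2) lookup_le_deg_in[of m f j] by auto
  next
    case False
    have "deg_in j f \<in> insert 0 ((\<lambda>m. Poly_Mapping.lookup m j) ` Poly_Mapping.keys f)"
      unfolding deg_in_def by (rule Max_in) auto
    then show ?thesis
      using False assms(2) by auto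
  qed
  then obtain m where m: "m \<in> Poly_Mapping.keys f" "Poly_Mapping.lookup m j = \<kappa> j"
    by blast
  show ?thesis
    using polys_keys_exps[OF f m(1)] m assms(3)
    by (intro bexI[of _ "restrict (Poly_Mapping.lookup m) {1..n}"]) (auto simp: in_keys_iff)
qed

section \<open>Apolarity on discs and exteriors of discs\<close>

lemma chart_point_mem:
  assumes r: "r > 0" and w: "fin \<or> w \<noteq> 0"
    and C: "C = (if fin then {z. norm (z - c) < r} else {z. norm (z - c) > r})"
  shows "norm w < 1 \<Longrightarrow> chart_point fin c (of_real r) w \<in> C"
proof -
  assume "norm w < 1"
  then show ?thesis
    using assms by (auto simp: chart_point_def norm_mult norm_divide divide_simps)
qed

lemma chart_point_mem_compl:
  assumes r: "r > 0" and w: "\<not> fin \<or> w \<noteq> 0" "norm w \<le> 1"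
    and C: "C = (if fin then {z. norm (z - c) < r} else {z. norm (z - c) > r})"
  shows "chart_point (\<not> fin) c (of_real r) w \<in> - C"
  using assms by (auto simp: chart_point_def norm_mult norm_divide field_simps not_less)

theorem theorem5p6:
  fixes n :: nat and \<kappa> :: "nat \<Rightarrow> nat" and C :: "nat \<Rightarrow> complex set" and f g :: cpoly
  assumes "\<forall>i\<in>{1..n}. open_disk (C i) \<or> open_disk_exterior (C i)"
    and "f \<in> polys n \<kappa>" and "g \<in> polys n \<kappa>"
    and "stable (\<Pi>\<^sub>E i\<in>{1..n}. C i) f"
    and "\<forall>j\<in>{1..n}. open_disk_exterior (C j) \<longrightarrow> deg_in j f = \<kappa> j"
    and "stable (\<Pi>\<^sub>E i\<in>{1..n}. - C i) g"
    and "\<forall>j\<in>{1..n}. open_disk (C j) \<longrightarrow> deg_in j g = \<kappa> j"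
  shows "bracket n \<kappa> f g \<noteq> 0"
proof -
  define fin where "fin i \<longleftrightarrow> open_disk (C i)" for i
  define F where "F \<alpha> = Poly_Mapping.lookup f (monomial_of {1..n} \<alpha>)" for \<alpha>
  define G where "G \<alpha> = Poly_Mapping.lookup g (monomial_of {1..n} \<alpha>)" for \<alpha>
  have "\<exists>c r. r > 0 \<and> (i \<in> {1..n} \<longrightarrow>
      C i = (if fin i then {z. norm (z - c) < r} else {z. norm (z - c) > r}))" for i
  proof (cases "i \<in> {1..n}")
    case True
    then have "if fin i then open_disk (C i) else open_disk_exterior (C i)"
      using assms(1) by (auto simp: fin_def)
    then show ?thesis
      unfolding open_disk_def open_disk_exterior_def by (cases "fin i") auto
  next
    case False
    then show ?thesis
      by (intro exI[of _ "0::complex"] exI[of _ "1::real"]) auto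
  qed
  then obtain c r where r: "\<And>i. r i > 0"
      and C: "\<And>i. i \<in> {1..n} \<Longrightarrow>
        C i = (if fin i then {z. norm (z - c i) < r i} else {z. norm (z - c i) > r i})"
    by metis
  have f: "(\<Sum>\<alpha>\<in>exps {1..n} \<kappa>. F \<alpha> *
      (\<Prod>i\<in>{1..n}. chart_point (fin i) (c i) (of_real (r i)) (w i) ^ \<alpha> i)) \<noteq> 0"
    if "\<forall>i\<in>{1..n}. norm (w i) < 1 \<and> (fin i \<or> w i \<noteq> 0)" for w
  proof -
    let ?x = "\<lambda>i\<in>{1..n}. chart_point (fin i) (c i) (of_real (r i)) (w i)"
    have "?x \<in> (\<Pi>\<^sub>E i\<in>{1..n}. C i)"
      using that r C by (auto intro!: chart_point_mem)
    then have "peval f ?x \<noteq> 0"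
      using assms(4) by (auto simp: stable_def)
    then show ?thesis
      by (simp add: peval_polys[OF assms(2)] F_def)
  qed
  have g: "(\<Sum>\<alpha>\<in>exps {1..n} \<kappa>. G \<alpha> *
      (\<Prod>i\<in>{1..n}. chart_point (\<not> fin i) (c i) (of_real (r i)) (w i) ^ \<alpha> i)) \<noteq> 0"
    if "\<forall>i\<in>{1..n}. norm (w i) \<le> 1 \<and> (\<not> fin i \<or> w i \<noteq> 0)" for w
  proof -
    let ?x = "\<lambda>i\<in>{1..n}. chart_point (\<not> fin i) (c i) (of_real (r i)) (w i)"
    have "?x \<in> (\<Pi>\<^sub>E i\<in>{1..n}. - C i)"
      using that r C by (intro restrict_PiE_iff[THEN iffD2] ballI chart_point_mem_compl) auto
    then have "peval g ?x \<noteq> 0"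
      using assms(6) by (auto simp: stable_def)
    then show ?thesis
      by (simp add: peval_polys[OF assms(3)] G_def)
  qed
  have nz_f: "peval f (\<lambda>i. chart_point (fin i) (c i) (of_real (r i)) (1 / 2)) \<noteq> 0"
    using f[of "\<lambda>_. 1 / 2"] by (simp add: peval_polys[OF assms(2)] F_def)
  have nz_g: "peval g (\<lambda>i. chart_point (\<not> fin i) (c i) (of_real (r i)) 1) \<noteq> 0"
    using g[of "\<lambda>_. 1"] by (simp add: peval_polys[OF assms(3)] G_def)
  have "(\<Sum>\<alpha>\<in>exps {1..n} \<kappa>. F \<alpha> * G (\<lambda>i\<in>{1..n}. \<kappa> i - \<alpha> i) *
    (\<Prod>i\<in>{1..n}. (- 1) ^ \<alpha> i * fact (\<alpha> i) * fact (\<kappa> i - \<alpha> i))) \<noteq> 0"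
  proof (rule bracket_form_nonzero[OF _ _ f g])
    show "\<exists>\<alpha>\<in>exps {1..n} \<kappa>. \<alpha> i = \<kappa> i \<and> F \<alpha> \<noteq> 0" if "i \<in> {1..n}" "\<not> fin i" for i
      using that assms(1,5) leading_exponent_exists[OF assms(2) _ _ nz_f, of i]
      by (auto simp: F_def fin_def)
    show "\<exists>\<alpha>\<in>exps {1..n} \<kappa>. \<alpha> i = \<kappa> i \<and> G \<alpha> \<noteq> 0" if "i \<in> {1..n}" "fin i" for i
      using that assms(7) leading_exponent_exists[OF assms(3) _ _ nz_g, of i]
      by (auto simp: G_def fin_def)
  qed (use r in \<open>auto simp: less_imp_neq[symmetric]\<close>)
  then show ?thesis
    by (simp add: bracket_eq_sum F_def G_def)
qed

end
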